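(* Assume the setting in the context, that $\det L_1\ne0$, that $M:=-L_1^{-1}L_0\in\mathbb R^{2d\times2d}$ is hyperbolic with $\dim E_s=\dim E_u=d$, that the columns of $V_s=\binom{X_s}{P_s}$, $V_u=\binom{X_u}{P_u}$ are bases of its stable and unstable subspaces $E_s,E_u$ with $MV_s=V_sD_s$, $MV_u=V_uD_u$, and that for some $K\ge1$, $\gamma>0$, $\|V_sD_s^k\|\le Ke^{-\gamma k}$ and $\|V_uD_u^{-k}\|\le Ke^{-\gamma k}$ for all $k\ge0$. For a $d\times d$ matrix $S$ let $$\widehat\Gamma_T(S)=\begin{pmatrix}X_s&X_uD_u^{-T}\\(P_s-SX_s)D_s^{\,T}&P_u-SX_u\end{pmatrix}$$ ($D_s^{\,T},D_u^{-T}$ are powers). Suppose that at a reference terminal Hessian $S_\star$ the matrix $X_s$ is nonsingular and $\widehat\Gamma_T(S_\star)$ is invertible for $T\ge T_0$ with uniformly bounded inverse. Let $\mathcal X$ be a convex terminal-state neighborhood of $x_\infty$ and let $\mathscr R$ be a class of terminal rewards $\rho$ with a uniform $C^3$ bound. Fix $0<\alpha_{\rm ter}<\gamma$ and assume $$\sup_{\rho\in\mathscr R}\sup_{x\in\mathcal X}\|D^2\rho(x)-S_\star\|\le\eta .$$ Put $G_\Gamma=\sup_{T\ge T_0}\|\widehat\Gamma_T(S_\star)^{-1}\|$, $C_X=\sup_{T\ge T_0}\|[X_sD_s^{\,T}\ \ X_u]\|$ and assume $G_\Gamma C_X\eta<1$. Let $C_\to$ be the resulting common one-sided terminal Green constant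 for $\{S:\|S-S_\star\|\le\eta\}$, and let $C_N$ be a common residual constant (both as in the context). Assume that common branch and data radii $R$ and $\delta_*$ (as in the context) have been chosen so that $$\theta:=8C_\to\|L_1^{-1}\|C_N(1+e^{-\alpha_{\rm ter}})R<1 .$$ Assume also that the initial-state neighborhood and $\mathscr R$ satisfy $d_\rho(x)=\|(x-x_\infty,D\rho(x_\infty)-p_\infty)\|<\delta_*$ for all $x$ in that neighborhood and $\rho\in\mathscr R$, and that the resulting terminal states lie in $\mathcal X$. Then for every $\rho\in\mathscr R$, every such initial state $x$ and every $T\ge T_0$ there is a local branch $(z^\rho,u^\rho)$, on the same neighborhood of initial states. Moreover there is a horizon-independent constant $C_{\rm ter}$ such that, for the same admissible initial state $x$, every $\rho,\widetilde\rho\in\mathscr R$, $T\ge T_0$ and $0\le t<T$, $$\|z_t^\rho-z_t^{\widetilde\rho}\|+\|u_t^\rho-u_t^{\widetilde\rho}\|\le C_{\rm ter}e^{-\alpha_{\rm ter}(T-t)}\|D(\rho-\widetilde\rho)\|_{L^\infty(\mathcal X)} .$$ In particular, with $\mathsf K_T^\rho(x)=u_0^\rho$ the initial control, $$\|\mathsf K_T^\rho(x)-\mathsf K_T^{\widetilde\rho}(x)\|\le C_{\rm ter}e^{-\alpha_{\rm ter}T}\|\rho-\widetilde\rho\|_{C^2(\mathcal X)} .$$ The gradients with respect to the initial state, $D_x\mathscr S_T^\rho(x)=p_0^\rho$, of the stationary objective $\mathscr S_T^\rho(x)=\rho(x_T^\rho)-\lambda\sum_{t=0}^{T-1}\ell(x_t^\rho,u_t^\rho)$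 obey the same $e^{-\alpha_{\rm ter}T}$ bound. The constants are horizon independent for every fixed $0<\alpha_{\rm ter}<\gamma$.
   Context: Setting. $U\subset\mathbb R^m$ compact convex, $\lambda>0$; dynamics $x_{t+1}=F(x_t,u_t)\in\mathbb R^d$, running cost $\ell$, Hamiltonian $H(x,u,p)=-\lambda\ell(x,u)+\langle p,F(x,u)\rangle$. Reference: $x_\infty=F(x_\infty,u_\infty)$, $p_\infty=H_x(x_\infty,u_\infty,p_\infty)$, $H_u(x_\infty,u_\infty,p_\infty)=0$, $u_\infty\in\operatorname{int}U$, $\det H_{uu}(x_\infty,u_\infty,p_\infty)\neq0$; $F,\ell$ are $C^3$ near the reference. By the implicit function theorem there are neighborhoods $\Omega$ of $(x_\infty,p_\infty)$, $V$ of $u_\infty$ (relatively compact in $\operatorname{int}U$) and a unique $C^2$ map $\nu:\Omega\to V$ with $H_u(x,\nu(x,p_+),p_+)=0$, $\nu(x_\infty,p_\infty)=u_\infty$. Put $$\mathcal F((x,p),(x^+,p^+))=\binom{x^+-F(x,\nu(x,p^+))}{p-H_x(x,\nu(x,p^+),p^+)},\qquad\widetilde{\mathcal F}(z,z^+)=\mathcal F((x_\infty,p_\infty)+z,(x_\infty,p_\infty)+z^+),$$ $L=D\widetilde{\mathcal F}(0,0)$, $L[h,h^+]=L_0h+L_1h^+$. Fixed compact balls $B_x,B_p\subset\mathbb R^d$ about $0$ and a convex $U_0$ relatively compact in $\operatorname{int}U$ are such that, on the tube $B_x\times B_p$ (contained in $\Omega-(x_\infty,p_\infty)$), $\nu$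 takes values in $U_0$, $D\nu$ and $D^2\nu$ are bounded, and $D^2\widetilde{\mathcal F}$ is bounded on $(B_x\times B_p)^2$. The rewards $\rho\in\mathscr R$ are real-valued and $C^3$ on a fixed open set containing $(x_\infty+B_x)\cup\mathcal X$, with $\|D^j\rho\|\le M_{\rm ter}$ there for $j=1,2,3$ and all $\rho\in\mathscr R$. Norms are Euclidean with induced operator norms. Residual constant. $N=\widetilde{\mathcal F}-L$ satisfies on the tube $\|N(a,b)\|\le C_N(\|a\|+\|b\|)^2$ and $\|N(a,b)-N(\tilde a,\tilde b)\|\le C_N(\|a\|+\|b\|+\|\tilde a\|+\|\tilde b\|)(\|a-\tilde a\|+\|b-\tilde b\|)$. One-sided terminal Green constant. With $v_T(t)=e^{-\alpha_{\rm ter}(T-t)}$, $P_x=(I\ 0)$, $R_S=(-S\ \ I)$, $C_\to$ is a constant such that for all $S$ with $\|S-S_\star\|\le\eta$ and all $T\ge T_0$ the solution of $h_{t+1}=Mh_t+g_t$ $(0\le t<T)$, $P_xh_0=0$, $R_Sh_T=b_T$ satisfies $\max_{0\le t\le T}\|h_t\|/v_T(t)\le C_\to(\|b_T\|+\max_{0\le s<T}\|g_s\|/v_T(s+1))$; such a constant exists because $\widehat\Gamma_T(S)^{-1}$ is bounded by $G_\Gamma/(1-G_\Gamma C_X\eta)$ for these $S$. Branches and common radii. For $z=(\xi,\pi)=(x-x_\infty,p-p_\infty)$ the endpoint map of $\rho$ is $\mathcal B_\rho(z_0,z_T)=(\xi_0,\ \pi_T-(D\rho(x_\infty+\xi_T)-D\rho(x_\infty)))$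 with datum $\Delta_\rho(x)=(x-x_\infty,D\rho(x_\infty)-p_\infty)$. Its linearized rows with $L$ have, uniformly in $\rho\in\mathscr R$, the uniform Green property with a common constant $C_G$ and exponent $\gamma$: for $T\ge T_0$ the problem $L[h_t,h_{t+1}]=f_t$, $D\mathcal B_\rho(0,0)[h_0,h_T]=b$ is uniquely solvable with $\|h_t\|\le C_G[(e^{-\gamma t}+e^{-\gamma(T-t)})\|b\|+\sum_{s=0}^{T-1}\kappa_T(t,s)\|f_s\|]$, $\kappa_T(t,s)=e^{-\gamma|t-s|}+e^{-\gamma(t+T-s)}+e^{-\gamma(T-t+s)}$. Fix $0<\alpha<\gamma/2$, $w_T(t)=e^{-\alpha t}+e^{-\alpha(T-t)}$, $\|z\|_{w,T}=\max_t\|z_t\|/w_T(t)$, $C_{\rm conv}=4\bigl(\frac1{1-q_-}+\frac{q_+}{1-q_+}\bigr)$, $q_\pm=e^{-(\gamma\pm2\alpha)}$, and $a=2C_GC_{\rm conv}C_N(1+e^\alpha)^2+16C_GM_{\rm ter}$. Common radii are $R>0$ with $2aR<1$ and such that $\|z\|_{w,T}\le R$ implies $z_t\in B_x\times B_p$ for all $t$, and $\delta_*=(R-aR^2)/C_G$. The local branch for $(\rho,x,T)$ is the unique $z^\rho$ with $\|z^\rho\|_{w,T}\le R$ such that, with $u^\rho_t=\nu(x^\rho_t,p^\rho_{t+1})$: $x_{t+1}=F(x_t,u_t)$, $p_t=H_x(x_t,u_t,p_{t+1})$, $H_u(x_t,u_t,p_{t+1})=0$ $(0\le t<T)$, $x_0=x$,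 $p_T=D\rho(x_T)$. *)

theory Defs
  imports "HOL-Analysis.Analysis"
begin

section \<open>Derivatives and norms\<close>

text \<open>The derivative as a bounded linear map.  Iterating it gives the higher derivatives as nested
  bounded linear maps, whose library norm is the induced operator norm of the multilinear form.\<close>

definition Dop :: "('a::real_normed_vector \<Rightarrow> 'b::real_normed_vector) \<Rightarrow> 'a \<Rightarrow> 'a \<Rightarrow>\<^sub>L 'b" where
  "Dop f x = Blinfun (frechet_derivative f (at x))"

text \<open>These predicates are meant for open \<open>S\<close>.\<close>

definition C1_on :: "'a::real_normed_vector set \<Rightarrow> ('a \<Rightarrow> 'b::real_normed_vector) \<Rightarrow> bool" where
  "C1_on S f \<longleftrightarrow> (\<forall>x\<in>S. f differentiable (at x)) \<and> continuous_on S (Dop f)"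

definition C2_on :: "'a::real_normed_vector set \<Rightarrow> ('a \<Rightarrow> 'b::real_normed_vector) \<Rightarrow> bool" where
  "C2_on S f \<longleftrightarrow> C1_on S f \<and> C1_on S (Dop f)"

definition C3_on :: "'a::real_normed_vector set \<Rightarrow> ('a \<Rightarrow> 'b::real_normed_vector) \<Rightarrow> bool" where
  "C3_on S f \<longleftrightarrow> C1_on S f \<and> C2_on S (Dop f)"

definition grad :: "('a::real_inner \<Rightarrow> real) \<Rightarrow> 'a \<Rightarrow> 'a" where
  "grad f x = (THE g. GDERIV f x :> g)"

definition hess :: "(real^'n \<Rightarrow> real) \<Rightarrow> real^'n \<Rightarrow> real^'n^'n" where
  "hess f x = jacobian (grad f) (at x)"

text \<open>The suprema are taken in the extended nonnegative reals because a reward itself (as opposed to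
  its derivatives) may be unbounded on \<open>X\<close>.\<close>

definition sup_norm :: "'a set \<Rightarrow> ('a \<Rightarrow> 'b::real_normed_vector) \<Rightarrow> ennreal" where
  "sup_norm X f = (SUP x\<in>X. ennreal (norm (f x)))"

definition C2_norm :: "'a::real_normed_vector set \<Rightarrow> ('a \<Rightarrow> 'b::real_normed_vector) \<Rightarrow> ennreal" where
  "C2_norm X f = max (sup_norm X f) (max (sup_norm X (Dop f)) (sup_norm X (Dop (Dop f))))"

section \<open>Matrices\<close>

text \<open>The library norm on \<open>real^'n^'m\<close> is the Frobenius norm, and its multiplication
  (hence \<open>^\<close>) is componentwise.\<close>

definition opnorm :: "real^'n^'m \<Rightarrow> real" where
  "opnorm A = onorm ((*v) A)"

primrec matpow :: "'a::semiring_1^'n^'n \<Rightarrow> nat \<Rightarrow> 'a^'n^'n" where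
  "matpow A 0 = mat 1"
| "matpow A (Suc k) = A ** matpow A k"

text \<open>Vertical stacking; applied to matrices (vectors of rows) it stacks blocks of rows.\<close>

definition vstack :: "'a^'n \<Rightarrow> 'a^'m \<Rightarrow> 'a^('n::finite + 'm::finite)" where
  "vstack a b = (\<chi> i. case i of Inl j \<Rightarrow> a $ j | Inr j \<Rightarrow> b $ j)"

definition hstack :: "'a^'n^'k \<Rightarrow> 'a^'m^'k \<Rightarrow> 'a^('n::finite + 'm::finite)^'k" where
  "hstack A B = (\<chi> i. vstack (A $ i) (B $ i))"

text \<open>The matrix, in stacked coordinates indexed by \<open>'d + 'd\<close>, of a linear map on pairs.\<close>

definition pair_matrix :: "((real^'d) \<times> (real^'d) \<Rightarrow> (real^'d) \<times> (real^'d)) \<Rightarrow> real^('d + 'd)^('d + 'd)" where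
  "pair_matrix f =
     matrix (\<lambda>v. let w = f ((\<chi> i. v $ Inl i), (\<chi> i. v $ Inr i)) in vstack (fst w) (snd w))"

definition hyperbolic :: "real^'n^'n \<Rightarrow> bool" where
  "hyperbolic A \<longleftrightarrow>
     (\<forall>\<mu> v. v \<noteq> 0 \<and> map_matrix complex_of_real A *v v = \<mu> *s v \<longrightarrow> cmod \<mu> \<noteq> 1)"

definition gen_eigenspace :: "real^'n^'n \<Rightarrow> complex \<Rightarrow> (complex^'n) set" where
  "gen_eigenspace A \<mu> = {v. \<exists>k. matpow (map_matrix complex_of_real A - mat \<mu>) k *v v = 0}"

text \<open>Real points of the sum of the complex generalized eigenspaces inside (outside) the unit disc.\<close>

definition stable_subspace :: "real^'n^'n \<Rightarrow> (real^'n) set" where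
  "stable_subspace A =
     {v. (\<chi> i. complex_of_real (v $ i)) \<in> vec.span (\<Union>\<mu>\<in>{\<mu>. cmod \<mu> < 1}. gen_eigenspace A \<mu>)}"

definition unstable_subspace :: "real^'n^'n \<Rightarrow> (real^'n) set" where
  "unstable_subspace A =
     {v. (\<chi> i. complex_of_real (v $ i)) \<in> vec.span (\<Union>\<mu>\<in>{\<mu>. cmod \<mu> > 1}. gen_eigenspace A \<mu>)}"

definition columns_basis :: "real^'k^'n \<Rightarrow> (real^'n) set \<Rightarrow> bool" where
  "columns_basis V E \<longleftrightarrow>
     inj (\<lambda>j. column j V) \<and> independent (columns V) \<and> span (columns V) = E"

definition Gamma_hat ::
    "real^'d^'d \<Rightarrow> real^'d^'d \<Rightarrow> real^'d^'d \<Rightarrow> real^'d^'d \<Rightarrow> real^'d^'d \<Rightarrow> real^'d^'d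
     \<Rightarrow> nat \<Rightarrow> real^'d^'d \<Rightarrow> real^('d + 'd)^('d + 'd)" where
  "Gamma_hat Xs Ps Xu Pu Ds Du T S =
     vstack (hstack Xs (Xu ** matpow (matrix_inv Du) T))
            (hstack ((Ps - S ** Xs) ** matpow Ds T) (Pu - S ** Xu))"

section \<open>The optimality system\<close>

definition ham :: "(real^'d \<Rightarrow> real^'m \<Rightarrow> real^'d) \<Rightarrow> (real^'d \<Rightarrow> real^'m \<Rightarrow> real) \<Rightarrow> real
    \<Rightarrow> real^'d \<Rightarrow> real^'m \<Rightarrow> real^'d \<Rightarrow> real" where
  "ham F l lam x u p = - lam * l x u + p \<bullet> F x u"

definition ham_x :: "(real^'d \<Rightarrow> real^'m \<Rightarrow> real^'d) \<Rightarrow> (real^'d \<Rightarrow> real^'m \<Rightarrow> real) \<Rightarrow> real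
    \<Rightarrow> real^'d \<Rightarrow> real^'m \<Rightarrow> real^'d \<Rightarrow> real^'d" where
  "ham_x F l lam x u p = grad (\<lambda>y. ham F l lam y u p) x"

definition ham_u :: "(real^'d \<Rightarrow> real^'m \<Rightarrow> real^'d) \<Rightarrow> (real^'d \<Rightarrow> real^'m \<Rightarrow> real) \<Rightarrow> real
    \<Rightarrow> real^'d \<Rightarrow> real^'m \<Rightarrow> real^'d \<Rightarrow> real^'m" where
  "ham_u F l lam x u p = grad (\<lambda>v. ham F l lam x v p) u"

definition ham_uu :: "(real^'d \<Rightarrow> real^'m \<Rightarrow> real^'d) \<Rightarrow> (real^'d \<Rightarrow> real^'m \<Rightarrow> real) \<Rightarrow> real
    \<Rightarrow> real^'d \<Rightarrow> real^'m \<Rightarrow> real^'d \<Rightarrow> real^'m^'m" where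
  "ham_uu F l lam x u p = hess (\<lambda>v. ham F l lam x v p) u"

definition opt_map :: "(real^'d \<Rightarrow> real^'m \<Rightarrow> real^'d) \<Rightarrow> (real^'d \<Rightarrow> real^'m \<Rightarrow> real) \<Rightarrow> real
    \<Rightarrow> ((real^'d) \<times> (real^'d) \<Rightarrow> real^'m)
    \<Rightarrow> ((real^'d) \<times> (real^'d)) \<times> ((real^'d) \<times> (real^'d)) \<Rightarrow> (real^'d) \<times> (real^'d)" where
  "opt_map F l lam nu = (\<lambda>((x, p), (x1, p1)).
     (x1 - F x (nu (x, p1)), p - ham_x F l lam x (nu (x, p1)) p1))"

definition residual_constant ::
    "((real^'d) \<times> (real^'d)) set
     \<Rightarrow> (((real^'d) \<times> (real^'d)) \<times> ((real^'d) \<times> (real^'d)) \<Rightarrow> (real^'d) \<times> (real^'d)) \<Rightarrow> real \<Rightarrow> bool" where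
  "residual_constant B N C \<longleftrightarrow>
     (\<forall>a\<in>B. \<forall>b\<in>B. norm (N (a, b)) \<le> C * (norm a + norm b)\<^sup>2) \<and>
     (\<forall>a\<in>B. \<forall>b\<in>B. \<forall>a'\<in>B. \<forall>b'\<in>B.
        norm (N (a, b) - N (a', b')) \<le>
          C * (norm a + norm b + norm a' + norm b') * (norm (a - a') + norm (b - b')))"

section \<open>Green properties\<close>

definition ter_weight :: "real \<Rightarrow> nat \<Rightarrow> nat \<Rightarrow> real" where
  "ter_weight \<alpha> T t = exp (- \<alpha> * (real T - real t))"

definition terminal_green_constant ::
    "real^('d + 'd)^('d + 'd) \<Rightarrow> real^'d^'d \<Rightarrow> real \<Rightarrow> real \<Rightarrow> nat \<Rightarrow> real \<Rightarrow> bool" where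
  "terminal_green_constant M Sstar \<eta> \<alpha> T0 C \<longleftrightarrow>
     (\<forall>(S :: real^'d^'d) T (h :: nat \<Rightarrow> real^('d + 'd)) g (b :: real^'d).
        opnorm (S - Sstar) \<le> \<eta> \<and> T0 \<le> T \<and>
        (\<forall>t<T. h (Suc t) = M *v h t + g t) \<and>
        hstack (mat 1 :: real^'d^'d) (0 :: real^'d^'d) *v h 0 = 0 \<and>
        hstack (- S) (mat 1 :: real^'d^'d) *v h T = b \<longrightarrow>
        (MAX t\<in>{..T}. norm (h t) / ter_weight \<alpha> T t)
          \<le> C * (norm b + (MAX s\<in>{..<T}. norm (g s) / ter_weight \<alpha> T (Suc s))))"

definition green_kernel :: "real \<Rightarrow> nat \<Rightarrow> nat \<Rightarrow> nat \<Rightarrow> real" where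
  "green_kernel \<gamma> T t s =
     exp (- \<gamma> * \<bar>real t - real s\<bar>) + exp (- \<gamma> * (real t + real T - real s))
     + exp (- \<gamma> * (real T - real t + real s))"

text \<open>\<open>L\<close> is the linearized system and \<open>B\<close> the linearized endpoint rows.  Sequences are total
  functions on \<open>nat\<close>, so uniqueness is asserted on \<open>{0..T}\<close> only.\<close>

definition uniform_green ::
    "(((real^'d) \<times> (real^'d)) \<times> ((real^'d) \<times> (real^'d)) \<Rightarrow> (real^'d) \<times> (real^'d))
     \<Rightarrow> (((real^'d) \<times> (real^'d)) \<times> ((real^'d) \<times> (real^'d)) \<Rightarrow> (real^'d) \<times> (real^'d))
     \<Rightarrow> real \<Rightarrow> nat \<Rightarrow> real \<Rightarrow> bool" where
  "uniform_green L B \<gamma> T0 C \<longleftrightarrow>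
     (\<forall>T\<ge>T0. \<forall>f :: nat \<Rightarrow> (real^'d) \<times> (real^'d). \<forall>b.
        let sol = (\<lambda>h. (\<forall>t<T. L (h t, h (Suc t)) = f t) \<and> B (h 0, h T) = b) in
        (\<exists>h. sol h) \<and>
        (\<forall>h h'. sol h \<and> sol h' \<longrightarrow> (\<forall>t\<le>T. h t = h' t)) \<and>
        (\<forall>h. sol h \<longrightarrow> (\<forall>t\<le>T.
           norm (h t) \<le> C * ((exp (- \<gamma> * real t) + exp (- \<gamma> * (real T - real t))) * norm b
                            + (\<Sum>s<T. green_kernel \<gamma> T t s * norm (f s))))))"

section \<open>Local branches\<close>

definition endpoint_map :: "real^'d \<Rightarrow> (real^'d \<Rightarrow> real)
    \<Rightarrow> ((real^'d) \<times> (real^'d)) \<times> ((real^'d) \<times> (real^'d)) \<Rightarrow> (real^'d) \<times> (real^'d)" where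
  "endpoint_map xinf \<rho> = (\<lambda>((\<xi>0, \<pi>0), (\<xi>T, \<pi>T)).
     (\<xi>0, \<pi>T - (grad \<rho> (xinf + \<xi>T) - grad \<rho> xinf)))"

definition weight :: "real \<Rightarrow> nat \<Rightarrow> nat \<Rightarrow> real" where
  "weight \<alpha> T t = exp (- \<alpha> * real t) + exp (- \<alpha> * (real T - real t))"

definition wnorm :: "real \<Rightarrow> nat \<Rightarrow> (nat \<Rightarrow> 'a::real_normed_vector) \<Rightarrow> real" where
  "wnorm \<alpha> T z = (MAX t\<in>{..T}. norm (z t) / weight \<alpha> T t)"

definition conv_constant :: "real \<Rightarrow> real \<Rightarrow> real" where
  "conv_constant \<gamma> \<alpha> =
     (let qm = exp (- (\<gamma> - 2 * \<alpha>)); qp = exp (- (\<gamma> + 2 * \<alpha>))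
      in 4 * (1 / (1 - qm) + qp / (1 - qp)))"

text \<open>Branches are stored as deviations \<open>z t = (x t - xinf, p t - pinf)\<close>.\<close>

definition branch_x :: "real^'d \<Rightarrow> (nat \<Rightarrow> (real^'d) \<times> (real^'d)) \<Rightarrow> nat \<Rightarrow> real^'d" where
  "branch_x xinf z t = xinf + fst (z t)"

definition branch_p :: "real^'d \<Rightarrow> (nat \<Rightarrow> (real^'d) \<times> (real^'d)) \<Rightarrow> nat \<Rightarrow> real^'d" where
  "branch_p pinf z t = pinf + snd (z t)"

definition branch_u :: "((real^'d) \<times> (real^'d) \<Rightarrow> real^'m) \<Rightarrow> real^'d \<Rightarrow> real^'d
    \<Rightarrow> (nat \<Rightarrow> (real^'d) \<times> (real^'d)) \<Rightarrow> nat \<Rightarrow> real^'m" where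
  "branch_u nu xinf pinf z t = nu (branch_x xinf z t, branch_p pinf z (Suc t))"

definition is_branch :: "(real^'d \<Rightarrow> real^'m \<Rightarrow> real^'d) \<Rightarrow> (real^'d \<Rightarrow> real^'m \<Rightarrow> real) \<Rightarrow> real
    \<Rightarrow> ((real^'d) \<times> (real^'d) \<Rightarrow> real^'m) \<Rightarrow> real^'d \<Rightarrow> real^'d \<Rightarrow> real \<Rightarrow> real
    \<Rightarrow> (real^'d \<Rightarrow> real) \<Rightarrow> nat \<Rightarrow> real^'d \<Rightarrow> (nat \<Rightarrow> (real^'d) \<times> (real^'d)) \<Rightarrow> bool" where
  "is_branch F l lam nu xinf pinf \<alpha> R \<rho> T x0 z \<longleftrightarrow>
     (let x = branch_x xinf z; p = branch_p pinf z; u = branch_u nu xinf pinf z in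
        wnorm \<alpha> T z \<le> R \<and>
        (\<forall>t<T. x (Suc t) = F (x t) (u t) \<and>
               p t = ham_x F l lam (x t) (u t) (p (Suc t)) \<and>
               ham_u F l lam (x t) (u t) (p (Suc t)) = 0) \<and>
        x 0 = x0 \<and> p T = grad \<rho> (x T))"

text \<open>Only the values on \<open>{0..T}\<close> are meaningful, and only when \<open>is_branch\<close> has a solution that
  is unique on \<open>{0..T}\<close>.\<close>

definition local_branch :: "(real^'d \<Rightarrow> real^'m \<Rightarrow> real^'d) \<Rightarrow> (real^'d \<Rightarrow> real^'m \<Rightarrow> real) \<Rightarrow> real
    \<Rightarrow> ((real^'d) \<times> (real^'d) \<Rightarrow> real^'m) \<Rightarrow> real^'d \<Rightarrow> real^'d \<Rightarrow> real \<Rightarrow> real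
    \<Rightarrow> (real^'d \<Rightarrow> real) \<Rightarrow> nat \<Rightarrow> real^'d \<Rightarrow> nat \<Rightarrow> (real^'d) \<times> (real^'d)" where
  "local_branch F l lam nu xinf pinf \<alpha> R \<rho> T x0 =
     (SOME z. is_branch F l lam nu xinf pinf \<alpha> R \<rho> T x0 z)"

definition stationary_objective :: "(real^'d \<Rightarrow> real^'m \<Rightarrow> real) \<Rightarrow> real
    \<Rightarrow> ((real^'d) \<times> (real^'d) \<Rightarrow> real^'m) \<Rightarrow> real^'d \<Rightarrow> real^'d
    \<Rightarrow> (real^'d \<Rightarrow> real) \<Rightarrow> nat \<Rightarrow> (nat \<Rightarrow> (real^'d) \<times> (real^'d)) \<Rightarrow> real" where
  "stationary_objective l lam nu xinf pinf \<rho> T z =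
     \<rho> (branch_x xinf z T)
     - lam * (\<Sum>t<T. l (branch_x xinf z t) (branch_u nu xinf pinf z t))"

end

theory Submission
  imports Defs
begin

text \<open>Subtracting the linearization turns the branch equations into \<open>L[z\<^sub>t, z\<^sub>t\<^sub>+\<^sub>1] = - N(z\<^sub>t, z\<^sub>t\<^sub>+\<^sub>1)\<close>
  with linear endpoint rows and a quadratic endpoint residual.  The uniform Green bound maps the
  squared two-sided weight back to the weight itself, so the problem is a contraction on a weighted
  ball: the branch exists, is unique, and depends on the initial state in a Lipschitz way.

  The difference of the branches of two rewards solves the linear recursion with a residual that is
  small relative to the difference, zero initial state, and a terminal row \<open>(- S  I)\<close>, where \<open>S\<close> is a
  secant matrix of the reward gradient within \<open>\<eta>\<close> of the reference Hessian.  The defect of that row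
  is the gradient difference of the rewards at a single terminal state.  The one-sided Green bound and
  \<open>\<theta> < 1\<close> absorb the residual.

  The gradient of the stationary objective is the initial costate because the Lagrangian is
  stationary in the remaining variables of the branch.\<close>

section \<open>Gradients\<close>

text \<open>The two-sided weight is of order one at time 0, so the estimate that produces the
  branches cannot show that a change of reward is exponentially damped there. The one-sided weight
  can, because the branches compared start at the same state. Its Green constant holds for a whole
  ball of terminal matrices, hence the matrix may depend on the two branches and need only send the
  difference of their terminal states to the difference of the reward gradients. A rank-one
  correction of \<open>Sstar\<close> does this, with norm controlled by the mean value inequality;
  no average of Hessians is formed.

  \<open>L\<close> and the endpoint rows are given as Frechet derivatives, which are known to be
  linear only where the maps are differentiable, so differentiability has to be settled before
  anything linear is used. Likewise the signs of \<open>CG\<close>, \<open>CN\<close> and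
  \<open>Mter\<close> are drawn from the estimates that contain them.

  The factor 8 in the smallness condition counts four states in the residual, each of norm at most
  \<open>2 * R\<close>.\<close>

definition riesz :: "('a::euclidean_space \<Rightarrow>\<^sub>L real) \<Rightarrow> 'a" where
  "riesz \<phi> = (\<Sum>b\<in>Basis. blinfun_apply \<phi> b *\<^sub>R b)"

lemma inner_riesz: "riesz \<phi> \<bullet> v = blinfun_apply \<phi> v"
proof -
  have "riesz \<phi> \<bullet> v = (\<Sum>b\<in>Basis. (v \<bullet> b) * blinfun_apply \<phi> b)"
    by (simp add: riesz_def inner_sum_left inner_commute[of v] mult.commute)
  also have "\<dots> = blinfun_apply \<phi> (\<Sum>b\<in>Basis. (v \<bullet> b) *\<^sub>R b)"
    by (simp add: blinfun.sum_right blinfun.scaleR_right)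
  finally show ?thesis
    by (simp add: euclidean_representation)
qed

text \<open>Through this isometry bounds on iterated \<open>Dop\<close> become bounds on
  \<open>grad\<close> with the same constants.\<close>

lemma norm_riesz: "norm (riesz \<phi>) = norm \<phi>"
proof (rule antisym)
  have "norm (riesz \<phi>) * norm (riesz \<phi>) = blinfun_apply \<phi> (riesz \<phi>)"
    by (metis inner_riesz dot_square_norm power2_eq_square)
  also have "\<dots> \<le> norm \<phi> * norm (riesz \<phi>)"
    using norm_blinfun[of \<phi> "riesz \<phi>"] by (simp add: abs_le_iff)
  finally show "norm (riesz \<phi>) \<le> norm \<phi>"
    by (metis mult_right_le_imp_le norm_ge_zero norm_not_less_zero order_le_less zero_less_norm_iff norm_zero)
  show "norm \<phi> \<le> norm (riesz \<phi>)"
    by (rule norm_blinfun_bound) (auto simp: Cauchy_Schwarz_ineq2 simp flip: inner_riesz)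
qed

lemma bounded_linear_riesz: "bounded_linear riesz"
proof (rule bounded_linear_intro[where K=1])
  show "riesz (x + y) = riesz x + riesz y" for x y :: "'a \<Rightarrow>\<^sub>L real"
    by (simp add: riesz_def blinfun.add_left scaleR_left_distrib sum.distrib)
  show "riesz (r *\<^sub>R x) = r *\<^sub>R riesz x" for r and x :: "'a \<Rightarrow>\<^sub>L real"
    by (simp add: riesz_def blinfun.scaleR_left scaleR_sum_right)
qed (simp add: norm_riesz)

lemma Dop_has_derivative:
  assumes "f differentiable (at x)"
  shows "(f has_derivative blinfun_apply (Dop f x)) (at x)"
proof -
  have d: "(f has_derivative frechet_derivative f (at x)) (at x)"
    using assms frechet_derivative_works by blast
  then show ?thesis
    unfolding Dop_def by (subst bounded_linear_Blinfun_apply) (auto dest: has_derivative_bounded_linear)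
qed

lemma GDERIV_imp_grad_eq:
  assumes "GDERIV f x :> g"
  shows "grad f x = g"
  unfolding grad_def
proof (rule the_equality)
  show "GDERIV f x :> g" by fact
  fix g' assume "GDERIV f x :> g'"
  then have "(\<lambda>h. h \<bullet> g') = (\<lambda>h. h \<bullet> g)"
    using assms unfolding gderiv_def by (rule has_derivative_unique)
  then have "\<forall>h. h \<bullet> g' = h \<bullet> g" by metis
  then show "g' = g" by (simp only: vector_eq_ldot)
qed

lemma GDERIV_riesz:
  fixes f :: "'a::euclidean_space \<Rightarrow> real"
  assumes "f differentiable (at x)"
  shows "GDERIV f x :> riesz (Dop f x)"
  using Dop_has_derivative[OF assms]
  by (simp add: gderiv_def inner_riesz inner_commute[of _ "riesz _"])

lemma grad_eq_riesz:
  fixes f :: "'a::euclidean_space \<Rightarrow> real"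
  assumes "f differentiable (at x)"
  shows "grad f x = riesz (Dop f x)"
  using GDERIV_imp_grad_eq GDERIV_riesz[OF assms] by blast

lemma grad_diff:
  fixes f g :: "'a::euclidean_space \<Rightarrow> real"
  assumes "f differentiable (at x)" "g differentiable (at x)"
  shows "grad (\<lambda>y. f y - g y) x = grad f x - grad g x"
  using assms by (intro GDERIV_imp_grad_eq GDERIV_diff) (auto simp: GDERIV_riesz grad_eq_riesz)

lemma has_derivative_grad:
  fixes f :: "'a::euclidean_space \<Rightarrow> real"
  assumes "open S" "x \<in> S" "C2_on S f"
  shows "(grad f has_derivative (\<lambda>h. riesz (Dop (Dop f) x h))) (at x)"
proof -
  have d: "((\<lambda>y. riesz (Dop f y)) has_derivative (\<lambda>h. riesz (Dop (Dop f) x h))) (at x)"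
    using assms(2,3)
    by (auto simp: C2_on_def C1_on_def
        intro!: bounded_linear.has_derivative[OF bounded_linear_riesz] Dop_has_derivative)
  show ?thesis
    using assms
    by (intro has_derivative_transform_within_open[OF d assms(1,2)])
      (auto simp: C2_on_def C1_on_def grad_eq_riesz)
qed

text \<open>Both partial gradients are restrictions of the one derivative on the product. The second
  claim expands over the basis so that the base point enters only through \<open>Dop f\<close>,
  which can be differentiated again.\<close>

lemma partial_gradients:
  fixes f :: "'a::euclidean_space \<times> 'b::euclidean_space \<Rightarrow> real"
  assumes "f differentiable (at (x, v))"
  shows "(f has_derivative (\<lambda>h. grad (\<lambda>y. f (y, v)) x \<bullet> fst h + grad (\<lambda>w. f (x, w)) v \<bullet> snd h))
           (at (x, v))"
    and "grad (\<lambda>y. f (y, v)) x = (\<Sum>b\<in>Basis. Dop f (x, v) (b, 0) *\<^sub>R b)"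
proof -
  let ?D = "Dop f (x, v)"
  have D: "(f has_derivative ?D) (at (x, v))"
    by (rule Dop_has_derivative) fact
  have d1: "((\<lambda>y. f (y, v)) has_derivative (\<lambda>h. ?D (h, 0))) (at x)"
    by (rule has_derivative_compose[of "\<lambda>y. (y, v)" "\<lambda>h. (h, 0)", OF _ D])
      (auto intro!: derivative_eq_intros)
  have d2: "((\<lambda>w. f (x, w)) has_derivative (\<lambda>h. ?D (0, h))) (at v)"
    by (rule has_derivative_compose[of "\<lambda>w. (x, w)" "\<lambda>h. (0, h)", OF _ D])
      (auto intro!: derivative_eq_intros)
  have g1: "grad (\<lambda>y. f (y, v)) x = riesz (Dop (\<lambda>y. f (y, v)) x)"
    using d1 by (intro grad_eq_riesz) (auto simp: differentiable_def)
  have g2: "grad (\<lambda>w. f (x, w)) v = riesz (Dop (\<lambda>w. f (x, w)) v)"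
    using d2 by (intro grad_eq_riesz) (auto simp: differentiable_def)
  have D1: "blinfun_apply (Dop (\<lambda>y. f (y, v)) x) = (\<lambda>h. ?D (h, 0))"
    using d1 by (intro has_derivative_unique[OF Dop_has_derivative d1]) (auto simp: differentiable_def)
  have D2: "blinfun_apply (Dop (\<lambda>w. f (x, w)) v) = (\<lambda>h. ?D (0, h))"
    using d2 by (intro has_derivative_unique[OF Dop_has_derivative d2]) (auto simp: differentiable_def)
  have split: "?D h = ?D (fst h, 0) + ?D (0, snd h)" for h
    by (simp flip: blinfun.add_right)
  have "blinfun_apply ?D = (\<lambda>h. grad (\<lambda>y. f (y, v)) x \<bullet> fst h + grad (\<lambda>w. f (x, w)) v \<bullet> snd h)"
    unfolding g1 g2 inner_riesz D1 D2 by (rule ext) (rule split)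
  with D show "(f has_derivative (\<lambda>h. grad (\<lambda>y. f (y, v)) x \<bullet> fst h + grad (\<lambda>w. f (x, w)) v \<bullet> snd h))
           (at (x, v))" by simp
  show "grad (\<lambda>y. f (y, v)) x = (\<Sum>b\<in>Basis. ?D (b, 0) *\<^sub>R b)"
    by (simp add: g1 D1 riesz_def)
qed

section \<open>Derivatives of the Hamiltonian and of the optimality map\<close>

lemma has_derivative_ham:
  fixes F :: "real^'d \<Rightarrow> real^'m \<Rightarrow> real^'d"
  assumes "(\<lambda>(x, v). F x v) differentiable (at (x, v))" "(\<lambda>(x, v). l x v) differentiable (at (x, v))"
  shows "((\<lambda>(x, v). ham F l lam x v p) has_derivative
            (\<lambda>h. ham_x F l lam x v p \<bullet> fst h + ham_u F l lam x v p \<bullet> snd h)) (at (x, v))"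
    and "ham_x F l lam x v p = (\<Sum>b\<in>Basis. (- lam * Dop (\<lambda>(x, v). l x v) (x, v) (b, 0)
           + p \<bullet> Dop (\<lambda>(x, v). F x v) (x, v) (b, 0)) *\<^sub>R b)"
proof -
  let ?H = "\<lambda>(x, v). ham F l lam x v p"
  have d: "(?H has_derivative (\<lambda>h. - lam * Dop (\<lambda>(x, v). l x v) (x, v) h
            + p \<bullet> Dop (\<lambda>(x, v). F x v) (x, v) h)) (at (x, v))"
    using Dop_has_derivative[OF assms(1)] Dop_has_derivative[OF assms(2)]
    unfolding ham_def split_beta by (auto intro!: derivative_eq_intros)
  then have diff: "?H differentiable (at (x, v))"
    by (auto simp: differentiable_def)
  show "(?H has_derivative
            (\<lambda>h. ham_x F l lam x v p \<bullet> fst h + ham_u F l lam x v p \<bullet> snd h)) (at (x, v))"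
    using partial_gradients(1)[OF diff] by (simp add: ham_x_def ham_u_def)
  have "blinfun_apply (Dop ?H (x, v)) = (\<lambda>h. - lam * Dop (\<lambda>(x, v). l x v) (x, v) h
            + p \<bullet> Dop (\<lambda>(x, v). F x v) (x, v) h)"
    by (rule has_derivative_unique[OF Dop_has_derivative[OF diff] d])
  then show "ham_x F l lam x v p = (\<Sum>b\<in>Basis. (- lam * Dop (\<lambda>(x, v). l x v) (x, v) (b, 0)
           + p \<bullet> Dop (\<lambda>(x, v). F x v) (x, v) (b, 0)) *\<^sub>R b)"
    using partial_gradients(2)[OF diff] by (simp add: ham_x_def)
qed

text \<open>Linearity of \<open>L\<close> rests on this. \<open>ham_x\<close> is a gradient defined
  by description, so near the point it is replaced by its expansion in \<open>Dop\<close> of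
  \<open>F\<close> and \<open>l\<close>. Differentiating that expansion takes two derivatives of
  \<open>F\<close> and \<open>l\<close> but only one of \<open>nu\<close>.\<close>

lemma differentiable_opt_map:
  fixes F :: "real^'d \<Rightarrow> real^'m \<Rightarrow> real^'d"
  assumes W: "open W" "C2_on W (\<lambda>(x, v). F x v)" "C2_on W (\<lambda>(x, v). l x v)"
    and \<Omega>: "open \<Omega>" "(x, p1) \<in> \<Omega>" "fst ` \<Omega> \<times> nu ` \<Omega> \<subseteq> W"
    and nu: "C1_on \<Omega> nu"
  shows "opt_map F l lam nu differentiable (at ((x, p), (x1, p1)))"
proof -
  let ?F = "\<lambda>(x, v). F x v" and ?l = "\<lambda>(x, v). l x v"
  let ?w = "((x, p), (x1, p1))"
  let ?g = "\<lambda>q :: ((real^'d) \<times> (real^'d)) \<times> ((real^'d) \<times> (real^'d)). (fst (fst q), snd (snd q))"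
  let ?k = "\<lambda>q. (fst (fst q), nu (?g q))"
  \<comment> \<open>Agrees with \<open>opt_map\<close> on \<open>?O\<close>, where
    \<open>(x, p1)\<close> stays in \<Omega> and therefore \<open>?k\<close> stays in
    \<open>W\<close>.\<close>
  let ?G = "\<lambda>q. (fst (snd q) - ?F (?k q),
     snd (fst q) - (\<Sum>b\<in>Basis. (- lam * Dop ?l (?k q) (b, 0) + snd (snd q) \<bullet> Dop ?F (?k q) (b, 0)) *\<^sub>R b))"
  let ?O = "?g -` \<Omega>"
  have fst_d: "fst differentiable (at q)" and snd_d: "snd differentiable (at q)"
    for q :: "'x::real_normed_vector \<times> 'y::real_normed_vector"
    by (simp_all add: bounded_linear_imp_differentiable bounded_linear_fst bounded_linear_snd)
  have xd: "(\<lambda>q. fst (fst q)) differentiable (at ?w)" and x1d: "(\<lambda>q. fst (snd q)) differentiable (at ?w)"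
    and pd: "(\<lambda>q. snd (fst q)) differentiable (at ?w)" and p1d: "(\<lambda>q. snd (snd q)) differentiable (at ?w)"
    by (auto intro!: differentiable_compose[OF fst_d] differentiable_compose[OF snd_d] fst_d snd_d)
  have gd: "?g differentiable (at ?w)"
    by (intro differentiable_Pair xd p1d)
  have "nu differentiable (at (?g ?w))"
    using nu \<Omega>(2) by (simp add: C1_on_def)
  then have nd: "(\<lambda>q. nu (?g q)) differentiable (at ?w)"
    by (rule differentiable_compose[OF _ gd])
  have kd: "?k differentiable (at ?w)"
    by (intro differentiable_Pair xd nd)
  have kW: "?k q \<in> W" if "q \<in> ?O" for q
    using that \<Omega>(3) by force
  have kw: "?k ?w \<in> W"
    using \<Omega>(2) by (intro kW) simp
  have Fd: "(\<lambda>q. ?F (?k q)) differentiable (at ?w)"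
    using W(2) kw by (intro differentiable_compose[OF _ kd]) (auto simp: C2_on_def C1_on_def)
  have DFd: "(\<lambda>q. Dop ?F (?k q)) differentiable (at ?w)"
    using W(2) kw by (intro differentiable_compose[OF _ kd]) (auto simp: C2_on_def C1_on_def)
  have Dld: "(\<lambda>q. Dop ?l (?k q)) differentiable (at ?w)"
    using W(3) kw by (intro differentiable_compose[OF _ kd]) (auto simp: C2_on_def C1_on_def)
  have ev: "(\<lambda>q. f q c) differentiable (at ?w)" if "f differentiable (at ?w)"
    for c and f :: "_ \<Rightarrow> 'x::real_normed_vector \<Rightarrow>\<^sub>L 'y::real_normed_vector"
    using that bounded_linear.has_derivative[OF blinfun.bounded_linear_left]
    unfolding differentiable_def by blast
  have sc: "(\<lambda>q. f q *\<^sub>R b) differentiable (at ?w)" if "f differentiable (at ?w)"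
    for f and b :: "real^'d"
    using that bounded_linear.has_derivative[OF bounded_linear_scaleR_left]
    unfolding differentiable_def by blast
  have "?G differentiable (at ?w)"
    by (intro differentiable_Pair differentiable_diff x1d pd Fd differentiable_sum ballI sc
        differentiable_add differentiable_mult differentiable_const differentiable_inner p1d ev DFd Dld)
      simp_all
  then obtain G' where G': "(?G has_derivative G') (at ?w)"
    by (auto simp: differentiable_def)
  have "open ?O"
    using \<Omega>(1) by (intro open_vimage continuous_intros) auto
  then have "(opt_map F l lam nu has_derivative G') (at ?w)"
  proof (rule has_derivative_transform_within_open[OF G'])
    show "?w \<in> ?O" using \<Omega> by simp
    fix q assume "q \<in> ?O"
    then have "?k q \<in> W" by (rule kW)
    then show "?G q = opt_map F l lam nu q"
      using W has_derivative_ham(2)[of F "fst (fst q)" "nu (?g q)" l lam "snd (snd q)"]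
      by (auto simp: opt_map_def split_beta C2_on_def C1_on_def)
  qed
  then show ?thesis by (auto simp: differentiable_def)
qed

section \<open>Mean value estimates for reward gradients\<close>

lemma has_derivative_grad_hess:
  fixes f :: "real^'n \<Rightarrow> real"
  assumes "open S" "x \<in> S" "C2_on S f"
  shows "(grad f has_derivative (*v) (hess f x)) (at x)"
proof -
  note d = has_derivative_grad[OF assms]
  have "frechet_derivative (grad f) (at x) = (\<lambda>h. riesz (Dop (Dop f) x h))"
    using frechet_derivative_at[OF d] by simp
  then show ?thesis
    using d has_derivative_linear[OF d] by (simp add: hess_def jacobian_def matrix_vector_mul(2))
qed

text \<open>Mean value inequality for the gradient minus the linear map \<open>A\<close>, whose
  derivative is the Hessian minus \<open>A\<close>. With \<open>A\<close> the reference Hessian this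
  is the bound that a secant matrix near it requires.\<close>

lemma grad_secant_bound:
  fixes f :: "real^'n \<Rightarrow> real"
  assumes D: "open D" "C2_on D f" and S: "convex S" "S \<subseteq> D"
    and close: "\<And>x. x \<in> S \<Longrightarrow> opnorm (hess f x - A) \<le> \<eta>" and xy: "x \<in> S" "y \<in> S"
  shows "norm (grad f x - grad f y - A *v (x - y)) \<le> \<eta> * norm (x - y)"
proof -
  have "norm ((grad f x - A *v x) - (grad f y - A *v y)) \<le> \<eta> * norm (x - y)"
  proof (rule differentiable_bound[OF S(1)])
    fix w assume w: "w \<in> S"
    then have "w \<in> D" using S by auto
    from has_derivative_grad_hess[OF D(1) this D(2)]
    have "((\<lambda>x. grad f x - A *v x) has_derivative (\<lambda>h. hess f w *v h - A *v h)) (at w)"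
      by (intro has_derivative_diff bounded_linear_imp_has_derivative matrix_vector_mul_bounded_linear)
    then show "((\<lambda>x. grad f x - A *v x) has_derivative (*v) (hess f w - A)) (at w within S)"
      by (simp add: has_derivative_at_withinI flip: matrix_vector_mult_diff_rdistrib)
    show "onorm ((*v) (hess f w - A)) \<le> \<eta>"
      using close[OF w] by (simp add: opnorm_def)
  qed (use xy in auto)
  then show ?thesis by (simp add: matrix_vector_mult_diff_distrib algebra_simps)
qed

text \<open>Two mean value inequalities: the third derivative bounds the variation of the second on
  a ball, and that variation bounds the derivative of the remainder on the same ball.\<close>

lemma grad_remainder_lipschitz:
  fixes f :: "'a::euclidean_space \<Rightarrow> real"
  assumes D: "open D" "C3_on D f" "cball c r \<subseteq> D"
    and bound: "\<And>x. x \<in> D \<Longrightarrow> norm (Dop (Dop (Dop f)) x) \<le> M" and M: "0 \<le> M"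
    and xy: "norm x \<le> r" "norm y \<le> r"
  shows "norm ((grad f (c + x) - riesz (Dop (Dop f) c x)) - (grad f (c + y) - riesz (Dop (Dop f) c y)))
    \<le> M * (norm x + norm y) * norm (x - y)"
proof -
  \<comment> \<open>The smallest centred ball containing both points. Its radius, in place of
    \<open>r\<close>, makes the Lipschitz constant proportional to the points, as for a quadratic
    remainder.\<close>
  define m where "m = max (norm x) (norm y)"
  have mem: "c + w \<in> D" if "w \<in> cball 0 m" for w
    using that xy D(3) by (auto simp: m_def dist_norm subset_iff)
  have m: "0 \<le> m" by (simp add: m_def le_max_iff_disj)
  let ?D2 = "Dop (Dop f)"
  have shift: "((\<lambda>w. g (c + w)) has_derivative g') (at w within T)"
    if "(g has_derivative g') (at (c + w))" for g :: "'a \<Rightarrow> 'x::real_normed_vector" and g' w T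
  proof -
    have "((\<lambda>w. c + w) has_derivative (\<lambda>h. h)) (at w)"
      by (auto intro!: derivative_eq_intros)
    from has_derivative_compose[OF this that] show ?thesis
      by (rule has_derivative_at_withinI)
  qed
  have D2: "norm (?D2 (c + w) - ?D2 c) \<le> M * m" if w: "w \<in> cball 0 m" for w
  proof -
    have "norm (?D2 (c + w) - ?D2 (c + 0)) \<le> M * norm (w - 0)"
    proof (rule differentiable_bound[OF convex_cball])
      fix v assume v: "v \<in> cball (0::'a) m"
      have "(?D2 has_derivative Dop ?D2 (c + v)) (at (c + v))"
        using D(2) mem[OF v] by (intro Dop_has_derivative) (auto simp: C3_on_def C2_on_def C1_on_def)
      then show "((\<lambda>w. ?D2 (c + w)) has_derivative Dop ?D2 (c + v)) (at v within cball 0 m)"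
        by (rule shift)
      show "onorm (Dop ?D2 (c + v)) \<le> M"
        using bound[OF mem[OF v]] by (simp add: norm_blinfun.rep_eq)
    qed (use w m in auto)
    also have "\<dots> \<le> M * m" using w M by (intro mult_left_mono) auto
    finally show ?thesis by simp
  qed
  have "norm ((Dop f (c + x) - ?D2 c x) - (Dop f (c + y) - ?D2 c y)) \<le> M * m * norm (x - y)"
  proof (rule differentiable_bound[OF convex_cball])
    fix v assume v: "v \<in> cball (0::'a) m"
    have "(Dop f has_derivative ?D2 (c + v)) (at (c + v))"
      using D(2) mem[OF v] by (intro Dop_has_derivative) (auto simp: C3_on_def C2_on_def C1_on_def)
    then have "((\<lambda>x. Dop f (c + x) - ?D2 c x) has_derivative (\<lambda>h. ?D2 (c + v) h - ?D2 c h)) (at v within cball 0 m)"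
      by (intro has_derivative_diff shift bounded_linear_imp_has_derivative blinfun.bounded_linear_right)
    then show "((\<lambda>x. Dop f (c + x) - ?D2 c x) has_derivative (?D2 (c + v) - ?D2 c)) (at v within cball 0 m)"
      by (simp add: minus_blinfun.rep_eq)
    show "onorm (?D2 (c + v) - ?D2 c) \<le> M * m"
      using D2[OF v] by (simp add: norm_blinfun.rep_eq)
  qed (auto simp: m_def)
  also have "\<dots> \<le> M * (norm x + norm y) * norm (x - y)"
    using M by (intro mult_right_mono mult_left_mono) (auto simp: m_def)
  finally have *: "norm ((Dop f (c + x) - ?D2 c x) - (Dop f (c + y) - ?D2 c y)) \<le> M * (norm x + norm y) * norm (x - y)" .
  have g: "grad f (c + w) = riesz (Dop f (c + w))" if "w \<in> cball 0 m" for w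
    using mem[OF that] D(2) by (intro grad_eq_riesz) (auto simp: C3_on_def C1_on_def)
  have "(grad f (c + x) - riesz (?D2 c x)) - (grad f (c + y) - riesz (?D2 c y))
      = riesz ((Dop f (c + x) - ?D2 c x) - (Dop f (c + y) - ?D2 c y))"
    by (subst (1 2) g) (auto simp: m_def linear_diff[OF bounded_linear.linear[OF bounded_linear_riesz]])
  then show ?thesis using * by (simp only: norm_riesz)
qed

section \<open>Stacked coordinates\<close>

lemma sum_UNIV_sum_type:
  fixes f :: "'n::finite + 'm::finite \<Rightarrow> 'a::comm_monoid_add"
  shows "sum f UNIV = (\<Sum>i\<in>UNIV. f (Inl i)) + (\<Sum>i\<in>UNIV. f (Inr i))"
proof -
  have "sum f UNIV = sum f (UNIV <+> UNIV)"
    by (rule arg_cong[OF UNIV_Plus_UNIV[symmetric]])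
  then show ?thesis by (simp only: sum.Plus finite o_def)
qed

text \<open>\<open>L\<close> acts on pairs and \<open>M\<close> on stacked vectors; this isometry
  carries the one-sided Green bound from one to the other without a constant.\<close>

lemma norm_vstack: "norm (vstack a b :: real^('n::finite + 'm::finite)) = norm (a, b)"
proof -
  have "(norm (vstack a b))\<^sup>2 = (\<Sum>i\<in>UNIV. (vstack a b $ i)\<^sup>2)"
    by (simp add: norm_vec_def L2_set_def sum_nonneg)
  also have "\<dots> = (\<Sum>i\<in>UNIV. (a $ i)\<^sup>2) + (\<Sum>i\<in>UNIV. (b $ i)\<^sup>2)"
    by (simp add: vstack_def sum_UNIV_sum_type)
  also have "\<dots> = (norm a)\<^sup>2 + (norm b)\<^sup>2"
    by (simp add: norm_vec_def L2_set_def sum_nonneg)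
  finally show ?thesis
    by (metis norm_Pair norm_ge_zero real_sqrt_unique)
qed

lemma vstack_add: "vstack a b + vstack c d = vstack (a + c) (b + d)"
  by (simp add: vstack_def vec_eq_iff split: sum.splits)

lemma vstack_scaleR: "r *\<^sub>R vstack a b = vstack (r *\<^sub>R a) (r *\<^sub>R b)"
  by (simp add: vstack_def vec_eq_iff split: sum.splits)

lemma hstack_mult_vstack:
  fixes A :: "real^'n^'k" and B :: "real^'m^'k"
  shows "hstack A B *v vstack a b = A *v a + B *v b"
  by (simp add: hstack_def vstack_def matrix_vector_mult_def vec_eq_iff
      sum_UNIV_sum_type)

lemma pair_matrix_mult:
  fixes f :: "(real^'d) \<times> (real^'d) \<Rightarrow> (real^'d) \<times> (real^'d)"
  assumes "linear f"
  shows "pair_matrix f *v vstack (fst h) (snd h) = vstack (fst (f h)) (snd (f h))"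
proof -
  let ?unstack = "\<lambda>v :: real^('d + 'd). (\<chi> i. v $ Inl i, \<chi> i. v $ Inr i)"
  have "linear ?unstack"
    by (auto simp: linear_iff vec_eq_iff)
  from linear_compose[OF this assms]
  have lin: "linear (\<lambda>v. f (?unstack v))" by (simp add: o_def)
  have "linear (\<lambda>w :: (real^'d) \<times> (real^'d). vstack (fst w) (snd w) :: real^('d+'d))"
    by (auto simp: linear_iff vstack_add vstack_scaleR)
  from linear_compose[OF lin this]
  have "linear (\<lambda>v. let w = f (?unstack v) in vstack (fst w) (snd w))"
    by (simp add: o_def Let_def)
  from fun_cong[OF matrix_vector_mul(2)[OF this], of "vstack (fst h) (snd h)"]
  show ?thesis
    by (simp add: pair_matrix_def Let_def vstack_def)
qed

lemma norm_matrix_vector_le_opnorm: "norm (A *v x) \<le> opnorm A * norm x"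
  unfolding opnorm_def by (rule onorm) simp

text \<open>Rank-one correction: \<open>S\<close> adds to \<open>S0\<close> the map that sends
  \<open>d\<close> to the defect \<open>e - S0 *v d\<close> and kills the orthogonal complement of
  \<open>d\<close>. Its operator norm is the norm of the defect divided by that of
  \<open>d\<close>.\<close>

lemma secant_matrix:
  fixes S0 :: "real^'d^'d"
  assumes "norm (e - S0 *v d) \<le> \<eta> * norm d" "d = 0 \<longrightarrow> e = 0" "0 \<le> \<eta>"
  obtains S where "S *v d = e" "opnorm (S - S0) \<le> \<eta>"
proof -
  define r where "r = e - S0 *v d"
  \<comment> \<open>For \<open>d = 0\<close> this is the zero map, so \<open>S = S0\<close>; hence
    the requirement \<open>e = 0\<close> in that case.\<close>
  define f where "f = (\<lambda>v. ((d \<bullet> v) / (norm d)\<^sup>2) *\<^sub>R r)"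
  have lin: "linear f"
    unfolding f_def by (auto simp: linear_iff inner_add_right add_divide_distrib scaleR_left_distrib)
  define S where "S = S0 + matrix f"
  have f: "matrix f *v v = f v" for v
    by (rule fun_cong[OF matrix_vector_mul(2)[OF lin]])
  have "norm (f v) \<le> \<eta> * norm v" for v
  proof (cases "d = 0")
    case True
    with assms(3) show ?thesis by (simp add: f_def)
  next
    case False
    have "norm (f v) = \<bar>d \<bullet> v\<bar> * norm r / (norm d)\<^sup>2"
      by (simp add: f_def)
    also have "\<dots> \<le> (norm d * norm v) * (\<eta> * norm d) / (norm d)\<^sup>2"
      using assms(1) by (intro divide_right_mono mult_mono Cauchy_Schwarz_ineq2) (auto simp: r_def)
    also have "\<dots> = \<eta> * norm v"
      using False by (simp add: power2_eq_square)
    finally show ?thesis .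
  qed
  then have "opnorm (S - S0) \<le> \<eta>"
    unfolding opnorm_def S_def by (intro onorm_le) (simp add: f)
  moreover have "S *v d = S0 *v d + f d"
    by (simp add: S_def matrix_vector_mult_add_rdistrib f)
  then have "S *v d = e"
    using assms(2) by (cases "d = 0") (auto simp: f_def r_def power2_norm_eq_inner)
  ultimately show ?thesis by (rule that[rotated])
qed

lemma matrix_vector_mult_uminus: "(- A) *v x = - (A *v x)" for A :: "real^'n^'m"
  using matrix_vector_mult_diff_rdistrib[of 0 A x] by simp

lemma matrix_inv_vector_cancel:
  fixes A :: "real^'n^'n"
  assumes "det A \<noteq> 0"
  shows "matrix_inv A *v (A *v x) = x"
proof -
  have "invertible A" using assms by (simp add: invertible_det_nz)
  then have "matrix_inv A ** A = mat 1"
    unfolding invertible_def matrix_inv_def by (rule someI2_ex) simp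
  then show ?thesis
    by (simp add: matrix_vector_mul_assoc)
qed

section \<open>Weighted sequences\<close>

lemma two_sided_geometric_sum_le:
  fixes a b :: real
  assumes "0 \<le> a" "a < 1" "0 \<le> b" "b < 1"
  shows "(\<Sum>s<T. if s \<le> t then a ^ (t - s) else b ^ (s - t)) \<le> 1 / (1 - a) + b / (1 - b)"
proof -
  have geo: "(\<Sum>j<n. c ^ j) \<le> 1 / (1 - c)" if "0 \<le> c" "c < 1" for c :: real and n
    using that by (simp add: sum_gp_strict divide_simps)
  \<comment> \<open>Lengthening the range past \<open>t\<close> adds nonnegative terms and lets the
    sum split at \<open>t\<close> even when \<open>T \<le> t\<close>.\<close>
  have "(\<Sum>s<T. if s \<le> t then a ^ (t - s) else b ^ (s - t))
      \<le> (\<Sum>s<Suc t + T. if s \<le> t then a ^ (t - s) else b ^ (s - t))"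
    using assms by (intro sum_mono2) auto
  also have "\<dots> = (\<Sum>s<Suc t. a ^ (t - s)) + (\<Sum>j<T. b ^ Suc j)"
    by (induction T) auto
  also have "(\<Sum>s<Suc t. a ^ (t - s)) = (\<Sum>j<Suc t. a ^ j)"
    using sum.nat_diff_reindex[of "\<lambda>j. a ^ j" "Suc t"] by simp
  also have "(\<Sum>j<T. b ^ Suc j) = b * (\<Sum>j<T. b ^ j)"
    by (simp add: sum_distrib_left)
  also have "(\<Sum>j<Suc t. a ^ j) + b * (\<Sum>j<T. b ^ j) \<le> 1 / (1 - a) + b * (1 / (1 - b))"
    using assms by (intro add_mono geo mult_left_mono)
  finally show ?thesis by simp
qed

lemma weight_pos: "0 < weight \<alpha> T t"
  by (simp add: weight_def add_pos_pos)

lemma weight_le_2: "0 < \<alpha> \<Longrightarrow> t \<le> T \<Longrightarrow> weight \<alpha> T t \<le> 2"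
proof -
  assume "0 < \<alpha>" "t \<le> T"
  then have "exp (- \<alpha> * real t) \<le> 1" "exp (- \<alpha> * (real T - real t)) \<le> 1" by auto
  then show ?thesis unfolding weight_def by linarith
qed

lemma weight_antimono: "\<alpha> \<le> \<gamma> \<Longrightarrow> t \<le> T \<Longrightarrow> weight \<gamma> T t \<le> weight \<alpha> T t"
  unfolding weight_def by (intro add_mono) (auto intro!: mult_right_mono)

lemma weight_Suc_le:
  assumes "0 < \<alpha>"
  shows "weight \<alpha> T (Suc t) \<le> exp \<alpha> * weight \<alpha> T t"
proof -
  have "exp (- \<alpha> * real (Suc t)) \<le> exp \<alpha> * exp (- \<alpha> * real t)"
    using assms unfolding mult_exp_exp by (simp add: algebra_simps)
  moreover have "exp (- \<alpha> * (real T - real (Suc t))) = exp \<alpha> * exp (- \<alpha> * (real T - real t))"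
    unfolding mult_exp_exp by (simp add: algebra_simps)
  ultimately show ?thesis by (simp add: weight_def distrib_left)
qed

text \<open>The residual couples two consecutive times. Expressing both in the weight at
  \<open>s\<close> costs the factor \<open>1 + exp \<alpha>\<close>, whose square appears in the
  contraction rate.\<close>

lemma add_le_weight:
  assumes "0 < \<alpha>" "0 \<le> k" "x \<le> k * weight \<alpha> T s" "y \<le> k * weight \<alpha> T (Suc s)"
  shows "x + y \<le> k * (1 + exp \<alpha>) * weight \<alpha> T s"
proof -
  have "k * weight \<alpha> T (Suc s) \<le> k * (exp \<alpha> * weight \<alpha> T s)"
    using assms by (intro mult_left_mono weight_Suc_le)
  with assms show ?thesis by (simp add: distrib_left distrib_right mult.assoc)
qed

lemma conv_constant_nonneg:
  assumes "0 < \<alpha>" "\<alpha> < \<gamma> / 2"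
  shows "0 \<le> conv_constant \<gamma> \<alpha>"
  using assms unfolding conv_constant_def Let_def by auto

text \<open>The squared weight consists, up to a factor 2, of exponentials of rate
  \<open>2 * \<alpha>\<close>. Moving such an exponential from \<open>s\<close> to \<open>t\<close>
  changes the kernel rate to \<open>\<gamma> - 2 * \<alpha>\<close> on one side of \<open>t\<close>
  and to \<open>\<gamma> + 2 * \<alpha>\<close> on the other, with sides exchanged for the terminal
  exponential. The condition \<open>\<alpha> < \<gamma> / 2\<close> keeps both rates
  positive.\<close>

lemma exponential_kernel_weight_sum_le:
  assumes \<alpha>: "0 < \<alpha>" "\<alpha> < \<gamma> / 2"
  shows "(\<Sum>s<T. exp (- \<gamma> * \<bar>real t - real s\<bar>) * (weight \<alpha> T s)\<^sup>2)
    \<le> conv_constant \<gamma> \<alpha> / 2 * weight (2 * \<alpha>) T t"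
proof -
  define qm where "qm = exp (- (\<gamma> - 2 * \<alpha>))"
  define qp where "qp = exp (- (\<gamma> + 2 * \<alpha>))"
  define c where "c = 1 / (1 - qm) + qp / (1 - qp)"
  define e1 where "e1 = (\<lambda>s. exp (- (2 * \<alpha>) * real s))"
  define e2 where "e2 = (\<lambda>s. exp (- (2 * \<alpha>) * (real T - real s)))"
  define A where "A = (\<lambda>s. if s \<le> t then qm ^ (t - s) else qp ^ (s - t))"
  define B where "B = (\<lambda>s. if s \<le> t then qp ^ (t - s) else qm ^ (s - t))"
  have q: "0 < qm" "qm < 1" "0 < qp" "qp < 1"
    using \<alpha> by (auto simp: qm_def qp_def)
  have sumA: "sum A {..<T} \<le> c"
    unfolding A_def c_def using q by (intro two_sided_geometric_sum_le) auto
  have "sum B {..<T} \<le> 1 / (1 - qp) + qm / (1 - qm)"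
    unfolding B_def using q by (intro two_sided_geometric_sum_le) auto
  \<comment> \<open>Since \<open>1 / (1 - q) = 1 + q / (1 - q)\<close>, exchanging the two ratios
    does not change the total.\<close>
  also have "\<dots> = c"
    using q by (simp add: c_def field_simps)
  finally have sumB: "sum B {..<T} \<le> c" .
  have kernel: "exp (- \<gamma> * \<bar>real t - real s\<bar>) * e1 s = A s * e1 t"
    "exp (- \<gamma> * \<bar>real t - real s\<bar>) * e2 s = B s * e2 t" for s
    by (auto simp: A_def B_def e1_def e2_def qm_def qp_def of_nat_diff algebra_simps
        simp flip: exp_of_nat_mult exp_add)
  have square: "(weight \<alpha> T s)\<^sup>2 \<le> 2 * (e1 s + e2 s)" for s
  proof -
    have "(x + y)\<^sup>2 \<le> 2 * (x\<^sup>2 + y\<^sup>2)" for x y :: real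
      using zero_le_power2[of "x - y"] by (simp add: power2_eq_square algebra_simps)
    moreover have "e1 s = (exp (- \<alpha> * real s))\<^sup>2" "e2 s = (exp (- \<alpha> * (real T - real s)))\<^sup>2"
      by (simp_all add: e1_def e2_def algebra_simps power2_eq_square mult_exp_exp)
    ultimately show ?thesis by (simp only: weight_def)
  qed
  have "(\<Sum>s<T. exp (- \<gamma> * \<bar>real t - real s\<bar>) * (weight \<alpha> T s)\<^sup>2)
      \<le> (\<Sum>s<T. exp (- \<gamma> * \<bar>real t - real s\<bar>) * (2 * (e1 s + e2 s)))"
    by (intro sum_mono mult_left_mono square) simp
  also have "\<dots> = (\<Sum>s<T. 2 * (exp (- \<gamma> * \<bar>real t - real s\<bar>) * e1 s + exp (- \<gamma> * \<bar>real t - real s\<bar>) * e2 s))"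
    by (simp add: algebra_simps)
  also have "\<dots> = (\<Sum>s<T. 2 * (A s * e1 t + B s * e2 t))"
    by (simp only: kernel)
  also have "\<dots> = 2 * (sum A {..<T} * e1 t + sum B {..<T} * e2 t)"
    by (simp add: sum_distrib_left sum_distrib_right sum.distrib)
  also have "\<dots> \<le> 2 * (c * e1 t + c * e2 t)"
    using sumA sumB by (intro mult_left_mono add_mono mult_right_mono) (auto simp: e1_def e2_def)
  also have "\<dots> = 2 * c * weight (2 * \<alpha>) T t"
    by (simp add: e1_def e2_def weight_def algebra_simps)
  also have "2 * c = conv_constant \<gamma> \<alpha> / 2"
    by (simp add: conv_constant_def Let_def c_def qm_def qp_def)
  finally show ?thesis .
qed

text \<open>The two reflected parts of the kernel are the direct part at \<open>t = T\<close> and \<open>t = 0\<close>, damped by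
  \<open>exp (- \<gamma> t)\<close> and \<open>exp (- \<gamma> (T - t))\<close>.\<close>

lemma green_kernel_weight_sum_le:
  assumes \<alpha>: "0 < \<alpha>" "\<alpha> < \<gamma> / 2" and t: "t \<le> T"
  shows "(\<Sum>s<T. green_kernel \<gamma> T t s * (weight \<alpha> T s)\<^sup>2) \<le> 2 * conv_constant \<gamma> \<alpha> * weight \<alpha> T t"
proof -
  define k where "k = conv_constant \<gamma> \<alpha>"
  define K where "K = (\<lambda>t. \<Sum>s<T. exp (- \<gamma> * \<bar>real t - real s\<bar>) * (weight \<alpha> T s)\<^sup>2)"
  have k: "0 \<le> k" using conv_constant_nonneg[OF \<alpha>] by (simp add: k_def)
  have K: "K r \<le> k / 2 * weight (2 * \<alpha>) T r" for r
    unfolding K_def k_def by (rule exponential_kernel_weight_sum_le[OF \<alpha>])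
  have ends: "K r \<le> k" if "r \<le> T" for r
  proof -
    have "k / 2 * weight (2 * \<alpha>) T r \<le> k / 2 * 2"
      using k that \<alpha> by (intro mult_left_mono weight_le_2) auto
    with K[of r] show ?thesis by simp
  qed
  have split: "green_kernel \<gamma> T t s = exp (- \<gamma> * \<bar>real t - real s\<bar>)
      + exp (- \<gamma> * real t) * exp (- \<gamma> * \<bar>real T - real s\<bar>)
      + exp (- \<gamma> * (real T - real t)) * exp (- \<gamma> * \<bar>real 0 - real s\<bar>)" if "s < T" for s
    using that by (simp add: green_kernel_def mult_exp_exp algebra_simps)
  have "(\<Sum>s<T. green_kernel \<gamma> T t s * (weight \<alpha> T s)\<^sup>2)
      = (\<Sum>s<T. (exp (- \<gamma> * \<bar>real t - real s\<bar>)
      + exp (- \<gamma> * real t) * exp (- \<gamma> * \<bar>real T - real s\<bar>)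
      + exp (- \<gamma> * (real T - real t)) * exp (- \<gamma> * \<bar>real 0 - real s\<bar>)) * (weight \<alpha> T s)\<^sup>2)"
    by (intro sum.cong) (simp_all only: split lessThan_iff)
  also have "\<dots> = K t + exp (- \<gamma> * real t) * K T + exp (- \<gamma> * (real T - real t)) * K 0"
    unfolding K_def distrib_right sum.distrib sum_distrib_left mult.assoc ..
  also have "\<dots> \<le> k / 2 * weight (2 * \<alpha>) T t + exp (- \<gamma> * real t) * k + exp (- \<gamma> * (real T - real t)) * k"
    by (intro add_mono K mult_left_mono ends) auto
  also have "\<dots> = k / 2 * weight (2 * \<alpha>) T t + k * weight \<gamma> T t"
    by (simp add: weight_def algebra_simps)
  also have "\<dots> \<le> k / 2 * weight \<alpha> T t + k * weight \<alpha> T t"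
    using k \<alpha> t by (intro add_mono mult_left_mono weight_antimono) auto
  also have "\<dots> \<le> 2 * k * weight \<alpha> T t"
    using mult_nonneg_nonneg[OF k less_imp_le[OF weight_pos[of \<alpha> T t]]] by simp
  finally show ?thesis by (simp add: k_def)
qed

lemma wnorm_le_iff: "wnorm \<alpha> T z \<le> R \<longleftrightarrow> (\<forall>t\<le>T. norm (z t) \<le> R * weight \<alpha> T t)"
  unfolding wnorm_def by (subst Max_le_iff) (auto simp: weight_pos pos_divide_le_eq)

text \<open>Sequences are total functions whose values after \<open>T\<close> are arbitrary, so the
  weighted norm is only a seminorm. Picard iteration from zero is therefore carried out at each time
  up to \<open>T\<close>, and the fixed point equation is claimed only there. The contraction
  hypothesis takes any bound \<open>c\<close>, so it applies to the iterates and to the distance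
  from the limit alike.\<close>

lemma weighted_contraction_fixed_point:
  fixes \<Phi> :: "(nat \<Rightarrow> 'a::banach) \<Rightarrow> nat \<Rightarrow> 'a" and T :: nat and w :: "nat \<Rightarrow> real" and R :: real
  defines "P \<equiv> \<lambda>z. \<forall>t\<le>T. norm (z t) \<le> R * w t"
  assumes w: "\<And>t. t \<le> T \<Longrightarrow> 0 < w t" and R: "0 \<le> R" and q: "0 \<le> q" "q < 1"
    and self: "\<And>z. P z \<Longrightarrow> P (\<Phi> z)"
    and contr: "\<And>z y c. P z \<Longrightarrow> P y \<Longrightarrow> \<forall>t\<le>T. norm (z t - y t) \<le> c * w t \<Longrightarrow>
        \<forall>t\<le>T. norm (\<Phi> z t - \<Phi> y t) \<le> q * c * w t"
  shows "\<exists>z. P z \<and> (\<forall>t\<le>T. \<Phi> z t = z t)"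
proof -
  define Z where "Z = (\<lambda>k. (\<Phi> ^^ k) (\<lambda>_. 0))"
  have PZ: "P (Z k)" for k
  proof (induction k)
    case 0
    then show ?case using R w by (auto simp: Z_def P_def less_imp_le)
  qed (use self in \<open>simp add: Z_def\<close>)
  have step: "\<forall>t\<le>T. norm (Z (Suc k) t - Z k t) \<le> q ^ k * R * w t" for k
  proof (induction k)
    case 0
    then show ?case using PZ[of 1] by (auto simp: Z_def P_def)
  next
    case (Suc k)
    from contr[OF PZ PZ this] show ?case by (simp add: Z_def mult.assoc)
  qed
  have "convergent (\<lambda>k. Z k t)" if "t \<le> T" for t
  proof -
    have "summable (\<lambda>k. Z (Suc k) t - Z k t)"
    proof (rule summable_comparison_test')
      show "summable (\<lambda>k. q ^ k * (R * w t))"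
        using q by (intro summable_mult2 summable_geometric) auto
      show "norm (Z (Suc k) t - Z k t) \<le> q ^ k * (R * w t)" for k
        using step[of k] that by (simp add: mult.assoc)
    qed
    then have "convergent (\<lambda>n. \<Sum>k<n. Z (Suc k) t - Z k t)"
      by (simp add: summable_iff_convergent)
    then have "convergent (\<lambda>n. Z n t - Z 0 t)"
      by (simp only: sum_lessThan_telescope[of "\<lambda>k. Z k t"])
    then have "convergent (\<lambda>n. (Z n t - Z 0 t) + Z 0 t)"
      by (intro convergent_add convergent_const)
    then show ?thesis by simp
  qed
  then have lim: "(\<lambda>k. Z k t) \<longlonglongrightarrow> lim (\<lambda>k. Z k t)" if "t \<le> T" for t
    using that by (simp add: convergent_LIMSEQ_iff)
  define z where "z = (\<lambda>t. lim (\<lambda>k. Z k t))"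
  have lim: "(\<lambda>k. Z k t) \<longlonglongrightarrow> z t" if "t \<le> T" for t
    using lim[OF that] by (simp add: z_def)
  have Pz: "P z"
    unfolding P_def
  proof safe
    fix t assume t: "t \<le> T"
    show "norm (z t) \<le> R * w t"
      using PZ t by (intro LIMSEQ_le_const2[OF tendsto_norm[OF lim[OF t]]]) (auto simp: P_def)
  qed
  have "\<Phi> z t = z t" if t: "t \<le> T" for t
  proof -
    have "norm (\<Phi> z t - z t) \<le> \<epsilon>" if "0 < \<epsilon>" for \<epsilon>
    proof -
      define e where "e = \<epsilon> / (2 * w t)"
      have e: "0 < e" using that w[OF t] by (simp add: e_def)
      have "\<forall>\<^sub>F k in sequentially. \<forall>s\<in>{..T}. norm (z s - Z k s) \<le> e * w s"
      \<comment> \<open>The contraction hypothesis needs one bound at all times at once; there are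
        finitely many times.\<close>
      proof (intro eventually_ball_finite ballI)
        fix s assume "s \<in> {..T}"
        then have "(\<lambda>k. norm (z s - Z k s)) \<longlonglongrightarrow> norm (z s - z s)" "0 < e * w s"
          using e w lim[of s] by (intro tendsto_norm tendsto_diff tendsto_const mult_pos_pos; simp)+
        then have "\<forall>\<^sub>F k in sequentially. norm (z s - Z k s) < e * w s"
          by (intro order_tendstoD) auto
        then show "\<forall>\<^sub>F k in sequentially. norm (z s - Z k s) \<le> e * w s"
          by (rule eventually_mono) simp
      qed simp
      then obtain K where K: "\<And>k s. K \<le> k \<Longrightarrow> s \<le> T \<Longrightarrow> norm (z s - Z k s) \<le> e * w s"
        unfolding eventually_sequentially by auto
      have "norm (\<Phi> z t - \<Phi> (Z K) t) \<le> q * e * w t"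
        using contr[OF Pz PZ, of K e] K t by auto
      also have "\<dots> \<le> 1 * e * w t"
        using q e w[OF t] by (intro mult_right_mono) auto
      finally have "norm (\<Phi> z t - Z (Suc K) t) \<le> e * w t" by (simp add: Z_def)
      moreover have "norm (z t - Z (Suc K) t) \<le> e * w t" using K t by simp
      ultimately have "norm (\<Phi> z t - z t) \<le> 2 * (e * w t)"
        using norm_triangle_ineq4[of "\<Phi> z t - Z (Suc K) t" "z t - Z (Suc K) t"] by simp
      also have "\<dots> = \<epsilon>" using w[OF t] by (simp add: e_def)
      finally show ?thesis .
    qed
    then have "norm (\<Phi> z t - z t) \<le> 0" by (rule field_le_epsilon[of _ 0, simplified])
    then show ?thesis by simp
  qed
  with Pz show ?thesis by auto
qed

section \<open>The two-point boundary value problem\<close>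

text \<open>Everything specific to the reward sits in the rows \<open>B\<close> and the residual
  \<open>E\<close>. The bound on \<open>E\<close> involves only the terminal entry, since the
  initial row is already linear.\<close>

locale weighted_bvp =
  fixes L N B E :: "((real^'d) \<times> (real^'d)) \<times> ((real^'d) \<times> (real^'d)) \<Rightarrow> (real^'d) \<times> (real^'d)"
    and tube :: "((real^'d) \<times> (real^'d)) set" and \<gamma> \<alpha> CG CN Mter R :: real and T0 T :: nat
  assumes linear_L: "linear L" and linear_B: "linear B"
    and green: "uniform_green L B \<gamma> T0 CG" and T: "T0 \<le> T"
    and CG: "0 \<le> CG" and CN: "0 \<le> CN" and Mter: "0 \<le> Mter" and R: "0 < R"
    and \<alpha>: "0 < \<alpha>" "\<alpha> < \<gamma> / 2"
    and residual: "residual_constant tube N CN"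
    and E0: "E (0, 0) = 0"
    and E_lipschitz: "\<And>v w v' w'. w \<in> tube \<Longrightarrow> w' \<in> tube \<Longrightarrow>
      norm (E (v, w) - E (v', w')) \<le> Mter * (norm w + norm w') * norm (w - w')"
    and in_tube: "\<And>y t. wnorm \<alpha> T y \<le> R \<Longrightarrow> t \<le> T \<Longrightarrow> y t \<in> tube"
begin

text \<open>The constant called \<open>a\<close> in the theorem: the interior residual gives the
  first summand, the endpoint residual the second.\<close>

definition rate where "rate = 2 * CG * conv_constant \<gamma> \<alpha> * CN * (1 + exp \<alpha>)\<^sup>2 + 16 * CG * Mter"

definition solves where
  "solves b z \<longleftrightarrow> (\<forall>t<T. L (z t, z (Suc t)) = - N (z t, z (Suc t))) \<and> B (z 0, z T) = b - E (z 0, z T)"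

lemma conv_nonneg: "0 \<le> conv_constant \<gamma> \<alpha>"
  using conv_constant_nonneg \<alpha> .

lemma rate_nonneg: "0 \<le> rate"
  unfolding rate_def using CG CN Mter conv_nonneg by auto

lemma norm_le: "wnorm \<alpha> T z \<le> R \<Longrightarrow> t \<le> T \<Longrightarrow> norm (z t) \<le> R * weight \<alpha> T t"
  by (simp add: wnorm_le_iff)

text \<open>The Green property read as an a priori estimate: every \<open>h\<close> solves the
  linear problem whose forcing and datum it generates itself. Forcing of the size of the squared
  weight then returns the weight.\<close>

lemma green_bound:
  assumes f: "\<And>s. s < T \<Longrightarrow> norm (L (h s, h (Suc s))) \<le> \<phi> * (weight \<alpha> T s)\<^sup>2" and \<phi>: "0 \<le> \<phi>"
    and b: "norm (B (h 0, h T)) \<le> \<beta>" and t: "t \<le> T"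
  shows "norm (h t) \<le> CG * (\<beta> + 2 * conv_constant \<gamma> \<alpha> * \<phi>) * weight \<alpha> T t"
proof -
  let ?w = "weight \<alpha> T"
  have "\<forall>h. (\<forall>s<T. L (h s, h (Suc s)) = f s) \<and> B (h 0, h T) = b \<longrightarrow> (\<forall>t\<le>T.
      norm (h t) \<le> CG * (weight \<gamma> T t * norm b + (\<Sum>s<T. green_kernel \<gamma> T t s * norm (f s))))"
    for f :: "nat \<Rightarrow> (real^'d) \<times> (real^'d)" and b
    using green T unfolding uniform_green_def Let_def weight_def by blast
  from this[of "\<lambda>s. L (h s, h (Suc s))" "B (h 0, h T)"] t
  have "norm (h t) \<le> CG * (weight \<gamma> T t * norm (B (h 0, h T))
         + (\<Sum>s<T. green_kernel \<gamma> T t s * norm (L (h s, h (Suc s)))))"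
    by blast
  also have "\<dots> \<le> CG * (?w t * \<beta> + \<phi> * (2 * conv_constant \<gamma> \<alpha> * ?w t))"
  proof (intro mult_left_mono add_mono CG)
    show "weight \<gamma> T t * norm (B (h 0, h T)) \<le> ?w t * \<beta>"
      using \<alpha> b t weight_pos[of \<alpha> T t] by (intro mult_mono weight_antimono) auto
    have "(\<Sum>s<T. green_kernel \<gamma> T t s * norm (L (h s, h (Suc s))))
        \<le> (\<Sum>s<T. green_kernel \<gamma> T t s * (\<phi> * (?w s)\<^sup>2))"
      using f by (intro sum_mono mult_left_mono) (auto simp: green_kernel_def)
    also have "\<dots> = \<phi> * (\<Sum>s<T. green_kernel \<gamma> T t s * (?w s)\<^sup>2)"
      by (simp add: sum_distrib_left mult.left_commute)
    also have "\<dots> \<le> \<phi> * (2 * conv_constant \<gamma> \<alpha> * ?w t)"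
      using \<phi> by (intro mult_left_mono green_kernel_weight_sum_le \<alpha> t)
    finally show "(\<Sum>s<T. green_kernel \<gamma> T t s * norm (L (h s, h (Suc s))))
        \<le> \<phi> * (2 * conv_constant \<gamma> \<alpha> * ?w t)" .
  qed
  finally show ?thesis by (simp add: algebra_simps)
qed

text \<open>Stated for a separate \<open>h\<close> so that it serves twice: for the difference of
  two images of the fixed point map, with \<open>b = 0\<close>, and for the difference of two
  solutions themselves.\<close>

lemma difference_bound:
  assumes z: "wnorm \<alpha> T z \<le> R" and y: "wnorm \<alpha> T y \<le> R"
    and close: "\<forall>t\<le>T. norm (z t - y t) \<le> c * weight \<alpha> T t"
    and hL: "\<And>t. t < T \<Longrightarrow> L (h t, h (Suc t)) = - (N (z t, z (Suc t)) - N (y t, y (Suc t)))"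
    and hB: "B (h 0, h T) = b - (E (z 0, z T) - E (y 0, y T))" and t: "t \<le> T"
  shows "norm (h t) \<le> (CG * norm b + 2 * rate * R * c) * weight \<alpha> T t"
proof -
  let ?w = "weight \<alpha> T" and ?e = "1 + exp \<alpha>"
  have "0 \<le> c * ?w 0" using close norm_ge_zero order_trans by blast
  then have c: "0 \<le> c" using weight_pos[of \<alpha> T 0] by (simp add: zero_le_mult_iff)
  have f: "norm (L (h s, h (Suc s))) \<le> (2 * CN * ?e\<^sup>2 * R * c) * (?w s)\<^sup>2" if s: "s < T" for s
  proof -
    have tu: "z s \<in> tube" "z (Suc s) \<in> tube" "y s \<in> tube" "y (Suc s) \<in> tube"
      using in_tube z y s by auto
    have "norm (L (h s, h (Suc s))) = norm (N (z s, z (Suc s)) - N (y s, y (Suc s)))"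
      using hL[OF s] by (simp only: norm_minus_cancel)
    also have "\<dots> \<le> CN * (norm (z s) + norm (z (Suc s)) + norm (y s) + norm (y (Suc s))) *
                (norm (z s - y s) + norm (z (Suc s) - y (Suc s)))"
      using residual tu unfolding residual_constant_def by blast
    also have "\<dots> \<le> CN * (2 * R * ?e * ?w s) * (c * ?e * ?w s)"
    proof (rule mult_mono[OF mult_left_mono])
      have "norm (z s) + norm (z (Suc s)) \<le> R * ?e * ?w s" "norm (y s) + norm (y (Suc s)) \<le> R * ?e * ?w s"
        using z y s R \<alpha> by (auto intro!: add_le_weight norm_le)
      then show "norm (z s) + norm (z (Suc s)) + norm (y s) + norm (y (Suc s)) \<le> 2 * R * ?e * ?w s"
        by simp
      show "norm (z s - y s) + norm (z (Suc s) - y (Suc s)) \<le> c * ?e * ?w s"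
        using close s c \<alpha> by (auto intro!: add_le_weight)
      show "0 \<le> CN * (2 * R * ?e * ?w s)"
        using CN R weight_pos[of \<alpha> T s] by simp
    qed (use CN in auto)
    finally show ?thesis by (simp add: power2_eq_square algebra_simps)
  qed
  have "norm (E (z 0, z T) - E (y 0, y T)) \<le> Mter * (norm (z T) + norm (y T)) * norm (z T - y T)"
    using in_tube z y by (intro E_lipschitz) auto
  also have "\<dots> \<le> Mter * (R * 2 + R * 2) * (c * 2)"
  proof (intro mult_mono mult_left_mono add_mono)
    have k: "k * ?w T \<le> k * 2" if "0 \<le> k" for k
      using that \<alpha> by (intro mult_left_mono weight_le_2) auto
    show "norm (z T) \<le> R * 2" "norm (y T) \<le> R * 2"
      using norm_le[OF z order_refl] norm_le[OF y order_refl] k[of R] R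
      by (meson less_imp_le order_trans)+
    show "norm (z T - y T) \<le> c * 2"
      using close k[OF c] order_trans by blast
  qed (use R Mter in auto)
  finally have "norm (B (h 0, h T)) \<le> norm b + 8 * Mter * R * c"
    unfolding hB using norm_triangle_ineq4[of b "E (z 0, z T) - E (y 0, y T)"] by simp
  from green_bound[OF f _ this t]
  have "norm (h t) \<le> CG * (norm b + 8 * Mter * R * c
          + 2 * conv_constant \<gamma> \<alpha> * (2 * CN * ?e\<^sup>2 * R * c)) * ?w t"
    using CN R c by simp
  also have "\<dots> \<le> (CG * norm b + 2 * rate * R * c) * ?w t"
  proof (rule mult_right_mono)
    \<comment> \<open>The interior terms agree exactly. The endpoint takes 8 of the 32 multiples of
      \<open>CG * Mter * R * c\<close> on the right.\<close>
    have "0 \<le> CG * Mter * R * c" using CG Mter R c by simp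
    then show "CG * (norm b + 8 * Mter * R * c + 2 * conv_constant \<gamma> \<alpha> * (2 * CN * ?e\<^sup>2 * R * c))
        \<le> CG * norm b + 2 * rate * R * c"
      by (simp add: rate_def algebra_simps)
  qed (simp add: less_imp_le weight_pos)
  finally show ?thesis .
qed

text \<open>Comparison with the zero sequence through the difference bound would give
  \<open>2 * rate * R\<^sup>2\<close>. The quadratic half of the residual bound saves the factor 2,
  which is what the data radius \<open>(R - a * R\<^sup>2) / CG\<close> presupposes.\<close>

lemma size_bound:
  assumes z: "wnorm \<alpha> T z \<le> R"
    and hL: "\<And>t. t < T \<Longrightarrow> L (h t, h (Suc t)) = - N (z t, z (Suc t))"
    and hB: "B (h 0, h T) = b - E (z 0, z T)" and t: "t \<le> T"
  shows "norm (h t) \<le> (CG * norm b + rate * R\<^sup>2) * weight \<alpha> T t"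
proof -
  let ?w = "weight \<alpha> T" and ?e = "1 + exp \<alpha>"
  have f: "norm (L (h s, h (Suc s))) \<le> (CN * ?e\<^sup>2 * R\<^sup>2) * (?w s)\<^sup>2" if s: "s < T" for s
  proof -
    have "norm (L (h s, h (Suc s))) = norm (N (z s, z (Suc s)))"
      using hL[OF s] by simp
    also have "\<dots> \<le> CN * (norm (z s) + norm (z (Suc s)))\<^sup>2"
      using residual in_tube[OF z] s unfolding residual_constant_def by auto
    also have "\<dots> \<le> CN * (R * ?e * ?w s)\<^sup>2"
    proof (intro mult_left_mono power_mono)
      show "norm (z s) + norm (z (Suc s)) \<le> R * ?e * ?w s"
        using z s R \<alpha> by (auto intro!: add_le_weight norm_le)
    qed (use CN in auto)
    finally show ?thesis by (simp only: power_mult_distrib mult.assoc mult.left_commute)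
  qed
  have zero: "wnorm \<alpha> T (\<lambda>_. 0 :: (real^'d) \<times> (real^'d)) \<le> R"
    using R by (simp add: wnorm_le_iff less_imp_le weight_pos)
  have "norm (E (z 0, z T) - E (0, 0)) \<le> Mter * (norm (z T) + norm (0 :: (real^'d) \<times> (real^'d))) * norm (z T - 0)"
    using in_tube[OF z] in_tube[OF zero] by (intro E_lipschitz) auto
  also have "\<dots> = Mter * (norm (z T) * norm (z T))" by simp
  also have "\<dots> \<le> Mter * ((R * 2) * (R * 2))"
  proof (intro mult_left_mono mult_mono)
    have "R * ?w T \<le> R * 2" using R \<alpha> by (intro mult_left_mono weight_le_2) auto
    then show "norm (z T) \<le> R * 2" using norm_le[OF z, of T] by simp
    then show "norm (z T) \<le> R * 2" .
  qed (use R Mter in auto)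
  finally have "norm (B (h 0, h T)) \<le> norm b + 4 * Mter * R\<^sup>2"
    unfolding hB using norm_triangle_ineq4[of b "E (z 0, z T)"] by (simp add: E0 power2_eq_square)
  from green_bound[OF f _ this t]
  have "norm (h t) \<le> CG * (norm b + 4 * Mter * R\<^sup>2
          + 2 * conv_constant \<gamma> \<alpha> * (CN * ?e\<^sup>2 * R\<^sup>2)) * ?w t"
    using CN R by simp
  also have "\<dots> \<le> (CG * norm b + rate * R\<^sup>2) * ?w t"
  proof (rule mult_right_mono)
    have "0 \<le> CG * Mter * R\<^sup>2" using CG Mter by simp
    then show "CG * (norm b + 4 * Mter * R\<^sup>2 + 2 * conv_constant \<gamma> \<alpha> * (CN * ?e\<^sup>2 * R\<^sup>2))
        \<le> CG * norm b + rate * R\<^sup>2"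
      by (simp add: rate_def algebra_simps)
  qed (simp add: less_imp_le weight_pos)
  finally show ?thesis .
qed

lemma solution_exists:
  assumes b: "CG * norm b + rate * R\<^sup>2 \<le> R" and aR: "2 * rate * R < 1"
  shows "\<exists>z. wnorm \<alpha> T z \<le> R \<and> solves b z"
proof -
  define sol where "sol = (\<lambda>z h. (\<forall>t<T. L (h t, h (Suc t)) = - N (z t, z (Suc t)))
      \<and> B (h 0, h T) = b - E (z 0, z T))"
  have "\<exists>h. sol z h" for z
  proof -
    have "\<exists>h. (\<forall>t<T. L (h t, h (Suc t)) = f t) \<and> B (h 0, h T) = b'" for f b'
      using green T unfolding uniform_green_def Let_def by blast
    then show ?thesis unfolding sol_def .
  qed
  \<comment> \<open>Any choice of linear solutions will do, as both bounds hold for each of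
    them.\<close>
  then obtain \<Phi> where \<Phi>: "sol z (\<Phi> z)" for z by metis
  have "\<exists>z. (\<forall>t\<le>T. norm (z t) \<le> R * weight \<alpha> T t) \<and> (\<forall>t\<le>T. \<Phi> z t = z t)"
  proof (rule weighted_contraction_fixed_point)
    show "0 \<le> 2 * rate * R" using rate_nonneg R by simp
    show "2 * rate * R < 1" by (rule aR)
    fix z :: "nat \<Rightarrow> (real^'d) \<times> (real^'d)"
    assume z: "\<forall>t\<le>T. norm (z t) \<le> R * weight \<alpha> T t"
    show "\<forall>t\<le>T. norm (\<Phi> z t) \<le> R * weight \<alpha> T t"
    proof safe
      fix t assume "t \<le> T"
      then have "norm (\<Phi> z t) \<le> (CG * norm b + rate * R\<^sup>2) * weight \<alpha> T t"
        using \<Phi>[of z] z by (intro size_bound[of z]) (auto simp: sol_def wnorm_le_iff)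
      also have "\<dots> \<le> R * weight \<alpha> T t"
        using b by (intro mult_right_mono) (auto simp: less_imp_le weight_pos)
      finally show "norm (\<Phi> z t) \<le> R * weight \<alpha> T t" .
    qed
    fix y c assume y: "\<forall>t\<le>T. norm (y t) \<le> R * weight \<alpha> T t"
      and c: "\<forall>t\<le>T. norm (z t - y t) \<le> c * weight \<alpha> T t"
    have "norm (\<Phi> z t - \<Phi> y t) \<le> (CG * norm (0 :: (real^'d) \<times> (real^'d)) + 2 * rate * R * c) * weight \<alpha> T t"
      if "t \<le> T" for t
    proof (rule difference_bound[of z y c "\<lambda>t. \<Phi> z t - \<Phi> y t"])
      show "L (\<Phi> z t - \<Phi> y t, \<Phi> z (Suc t) - \<Phi> y (Suc t)) = - (N (z t, z (Suc t)) - N (y t, y (Suc t)))"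
        if "t < T" for t
        using \<Phi>[of z] \<Phi>[of y] that
          linear_diff[OF linear_L, of "(\<Phi> z t, \<Phi> z (Suc t))" "(\<Phi> y t, \<Phi> y (Suc t))"]
        by (simp add: sol_def)
      show "B (\<Phi> z 0 - \<Phi> y 0, \<Phi> z T - \<Phi> y T) = 0 - (E (z 0, z T) - E (y 0, y T))"
        using \<Phi>[of z] \<Phi>[of y]
          linear_diff[OF linear_B, of "(\<Phi> z 0, \<Phi> z T)" "(\<Phi> y 0, \<Phi> y T)"]
        by (simp add: sol_def)
    qed (use z y c that in \<open>auto simp: wnorm_le_iff\<close>)
    then show "\<forall>t\<le>T. norm (\<Phi> z t - \<Phi> y t) \<le> 2 * rate * R * c * weight \<alpha> T t" by simp
  qed (use R in \<open>auto simp: weight_pos\<close>)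
  then obtain z where z: "wnorm \<alpha> T z \<le> R" "\<And>t. t \<le> T \<Longrightarrow> \<Phi> z t = z t"
    by (auto simp: wnorm_le_iff)
  with \<Phi>[of z] show ?thesis by (auto simp: sol_def solves_def)
qed

text \<open>The difference bound with \<open>c\<close> the weighted norm of the difference itself,
  which \<open>2 * rate * R < 1\<close> absorbs. For \<open>b = b'\<close> this is
  uniqueness.\<close>

lemma solution_lipschitz:
  assumes z: "wnorm \<alpha> T z \<le> R" "solves b z" and y: "wnorm \<alpha> T y \<le> R" "solves b' y"
    and aR: "2 * rate * R < 1" and t: "t \<le> T"
  shows "norm (z t - y t) \<le> CG / (1 - 2 * rate * R) * norm (b - b') * weight \<alpha> T t"
proof -
  define c where "c = wnorm \<alpha> T (\<lambda>t. z t - y t)"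
  have c: "\<forall>t\<le>T. norm (z t - y t) \<le> c * weight \<alpha> T t"
    unfolding wnorm_le_iff[symmetric] c_def by simp
  have "norm (z t - y t) \<le> (CG * norm (b - b') + 2 * rate * R * c) * weight \<alpha> T t" if "t \<le> T" for t
  proof (rule difference_bound[OF z(1) y(1) c, of "\<lambda>t. z t - y t"])
    show "L (z t - y t, z (Suc t) - y (Suc t)) = - (N (z t, z (Suc t)) - N (y t, y (Suc t)))"
      if "t < T" for t
      using z(2) y(2) that linear_diff[OF linear_L, of "(z t, z (Suc t))" "(y t, y (Suc t))"]
      by (simp add: solves_def)
    show "B (z 0 - y 0, z T - y T) = b - b' - (E (z 0, z T) - E (y 0, y T))"
      using z(2) y(2) linear_diff[OF linear_B, of "(z 0, z T)" "(y 0, y T)"]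
      by (simp add: solves_def)
  qed (use that in auto)
  then have "c \<le> CG * norm (b - b') + 2 * rate * R * c"
    unfolding c_def wnorm_le_iff by (simp add: c_def)
  then have "c \<le> CG / (1 - 2 * rate * R) * norm (b - b')"
    using aR by (simp add: field_simps)
  then show ?thesis
    using c t weight_pos[of \<alpha> T t] by (meson mult_right_mono less_imp_le order_trans)
qed

end

section \<open>Endpoint rows and their quadratic residual\<close>

lemma has_derivative_endpoint_map:
  assumes "open D" "xinf \<in> D" "C2_on D \<rho>"
  shows "(endpoint_map xinf \<rho> has_derivative
      (\<lambda>h. (fst (fst h), snd (snd h) - riesz (Dop (Dop \<rho>) xinf (fst (snd h)))))) (at (0, 0))"
proof -
  have g: "(grad \<rho> has_derivative (\<lambda>h. riesz (Dop (Dop \<rho>) xinf h))) (at xinf)"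
    using assms by (rule has_derivative_grad)
  have "((\<lambda>w :: (((real^'a) \<times> (real^'a)) \<times> ((real^'a) \<times> (real^'a))). grad \<rho> (xinf + fst (snd w)))
      has_derivative (\<lambda>h. riesz (Dop (Dop \<rho>) xinf (fst (snd h))))) (at (0, 0))"
    by (rule has_derivative_compose[of "\<lambda>w. xinf + fst (snd w)" "\<lambda>h. fst (snd h)"])
      (use g in \<open>auto intro!: derivative_eq_intros simp: zero_prod_def\<close>)
  then show ?thesis
    unfolding endpoint_map_def split_beta by (auto intro!: derivative_eq_intros)
qed

text \<open>The initial row is linear and cancels, so up to a constant and a sign only the
  first-order Taylor remainder of the reward gradient at \<open>xinf\<close> survives in the
  terminal row.\<close>

lemma endpoint_residual_lipschitz:
  fixes B :: "((real^'d) \<times> (real^'d)) \<times> ((real^'d) \<times> (real^'d)) \<Rightarrow> (real^'d) \<times> (real^'d)"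
  assumes D: "open D" "C3_on D \<rho>" "cball xinf r \<subseteq> D" "0 \<le> r"
    and bound: "\<And>x. x \<in> D \<Longrightarrow> norm (Dop (Dop (Dop \<rho>)) x) \<le> M" "0 \<le> M"
    and B: "B = frechet_derivative (endpoint_map xinf \<rho>) (at (0, 0))"
    and E: "E = (\<lambda>w. endpoint_map xinf \<rho> w - B w)"
  shows "linear B" and "E (0, 0) = 0"
    and "norm (fst w) \<le> r \<Longrightarrow> norm (fst w') \<le> r \<Longrightarrow>
      norm (E (v, w) - E (v', w')) \<le> M * (norm w + norm w') * norm (w - w')"
proof -
  have xinf: "xinf \<in> D" using D(3,4) by (auto simp: subset_iff)
  have d: "(endpoint_map xinf \<rho> has_derivative
      (\<lambda>h. (fst (fst h), snd (snd h) - riesz (Dop (Dop \<rho>) xinf (fst (snd h)))))) (at (0, 0))"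
    using D xinf by (intro has_derivative_endpoint_map[of D]) (auto simp: C3_on_def C2_on_def)
  then have B_eq: "B = (\<lambda>h. (fst (fst h), snd (snd h) - riesz (Dop (Dop \<rho>) xinf (fst (snd h)))))"
    using frechet_derivative_at[OF d] by (simp add: B)
  show "linear B" using has_derivative_linear[OF d] by (simp add: B_eq)
  then have "B (0, 0) = 0" using linear_0[of B] by (simp add: zero_prod_def)
  then show "E (0, 0) = 0" by (simp add: E endpoint_map_def zero_prod_def)
  assume w: "norm (fst w) \<le> r" "norm (fst w') \<le> r"
  let ?r = "\<lambda>x. grad \<rho> (xinf + x) - riesz (Dop (Dop \<rho>) xinf x)"
  have "E (v, w) = (0, grad \<rho> xinf - ?r (fst w))" for v w
    by (simp add: E B_eq endpoint_map_def split_beta)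
  then have "E (v, w) - E (v', w') = (0, - (?r (fst w) - ?r (fst w')))"
    by simp
  then have "norm (E (v, w) - E (v', w')) = norm (?r (fst w) - ?r (fst w'))"
    by (simp only: norm_Pair norm_minus_cancel) simp
  also have "\<dots> \<le> M * (norm (fst w) + norm (fst w')) * norm (fst w - fst w')"
    using D bound w by (intro grad_remainder_lipschitz)
  also have "\<dots> \<le> M * (norm w + norm w') * norm (w - w')"
  proof -
    have "norm (fst x) \<le> norm x" for x :: "(real^'d) \<times> (real^'d)"
      using norm_fst_le[of "fst x" "snd x"] by simp
    from this[of w] this[of w'] this[of "w - w'"] show ?thesis
      using bound(2) by (intro mult_mono mult_left_mono add_mono) auto
  qed
  finally show "norm (E (v, w) - E (v', w')) \<le> M * (norm w + norm w') * norm (w - w')" .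
qed

section \<open>Terminal perturbations\<close>

text \<open>The branches enter only through a uniform size bound \<open>r\<close>; decay comes
  solely from the one-sided weight. Measuring the difference by its own weighted maximum
  \<open>D\<close> makes the residual a small multiple of \<open>D\<close>.\<close>

lemma terminal_difference_bound:
  fixes L :: "((real^'d) \<times> (real^'d)) \<times> ((real^'d) \<times> (real^'d)) \<Rightarrow> (real^'d) \<times> (real^'d)"
  assumes L: "linear L" and L1: "L1 = pair_matrix (\<lambda>h. L (0, h))" "det L1 \<noteq> 0"
    and M: "M = - (matrix_inv L1 ** pair_matrix (\<lambda>h. L (h, 0)))"
    and green: "terminal_green_constant M S0 \<eta> \<alpha> T0 C" and T: "T0 \<le> T" "0 < T"
    and residual: "residual_constant tube N CN" "0 \<le> CN"
    and z: "\<And>t. t \<le> T \<Longrightarrow> z t \<in> tube" "\<And>t. t \<le> T \<Longrightarrow> norm (z t) \<le> r"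
    and y: "\<And>t. t \<le> T \<Longrightarrow> y t \<in> tube" "\<And>t. t \<le> T \<Longrightarrow> norm (y t) \<le> r"
    and eqn: "\<And>t. t < T \<Longrightarrow>
      L (z t - y t, z (Suc t) - y (Suc t)) = - (N (z t, z (Suc t)) - N (y t, y (Suc t)))"
    and S: "opnorm (S - S0) \<le> \<eta>"
    and ends: "fst (z 0) = fst (y 0)" "snd (z T - y T) = S *v fst (z T - y T) + b"
    and \<theta>: "\<theta> = 4 * C * opnorm (matrix_inv L1) * CN * (1 + exp (- \<alpha>)) * r" "\<theta> < 1"
    and t: "t \<le> T"
  shows "norm (z t - y t) \<le> \<bar>C\<bar> / (1 - \<theta>) * norm b * ter_weight \<alpha> T t"
proof -
  define d where "d = (\<lambda>t. z t - y t)"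
  define st :: "(real^'d) \<times> (real^'d) \<Rightarrow> real^('d + 'd)" where "st = (\<lambda>w. vstack (fst w) (snd w))"
  define v where "v = ter_weight \<alpha> T"
  define I where "I = opnorm (matrix_inv L1)"
  define D where "D = (MAX t\<in>{..T}. norm (st (d t)) / v t)"
  \<comment> \<open>Applying the inverse of \<open>L1\<close> to the equation turns it into an
    explicit recursion with matrix \<open>M\<close> and this forcing.\<close>
  define g where "g = (\<lambda>t. matrix_inv L1 *v st (L (d t, d (Suc t))))"
  have st_norm: "norm (st w) = norm w" for w
    by (simp add: st_def norm_vstack)
  have st_add: "st (w + w') = st w + st w'" for w w'
    by (simp add: st_def vstack_add)
  have v: "0 < v t" for t by (simp add: v_def ter_weight_def)
  have I: "0 \<le> I" unfolding I_def opnorm_def by (intro onorm_pos_le) simp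
  have r: "0 \<le> r" using z(2)[of 0] norm_ge_zero order_trans by blast
  have dD: "norm (d t) \<le> D * v t" if "t \<le> T" for t
  proof -
    have "norm (st (d t)) / v t \<le> D"
      unfolding D_def using that by (intro Max_ge) auto
    then show ?thesis using v by (simp add: pos_divide_le_eq st_norm)
  qed
  have D: "0 \<le> D"
    using dD[of 0] v[of 0] norm_ge_zero[of "d 0"] by (smt (verit) T zero_le_mult_iff le0)
  have lin0: "linear (\<lambda>h. L (h, 0))" and lin1: "linear (\<lambda>h. L (0, h))"
    using linear_compose[OF _ L, of "\<lambda>h. (h, 0)"] linear_compose[OF _ L, of "\<lambda>h. (0, h)"]
    by (auto simp: o_def linear_iff)
  have step: "st (d (Suc t)) = M *v st (d t) + g t" for t
  proof -
    have "L (d t, d (Suc t)) = L (d t, 0) + L (0, d (Suc t))"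
      using linear_add[OF L, of "(d t, 0)" "(0, d (Suc t))"] by simp
    then have "st (L (d t, d (Suc t))) = pair_matrix (\<lambda>h. L (h, 0)) *v st (d t) + L1 *v st (d (Suc t))"
      using pair_matrix_mult[OF lin0, of "d t"] pair_matrix_mult[OF lin1, of "d (Suc t)"]
      by (simp add: L1(1) st_add) (simp add: st_def)
    then have "g t = matrix_inv L1 *v (pair_matrix (\<lambda>h. L (h, 0)) *v st (d t)) + st (d (Suc t))"
      unfolding g_def by (simp only: matrix_vector_right_distrib matrix_inv_vector_cancel[OF L1(2)])
    then show ?thesis
      by (simp add: M matrix_vector_mul_assoc matrix_vector_mult_uminus)
  qed
  have start: "hstack (mat 1 :: real^'d^'d) (0 :: real^'d^'d) *v st (d 0) = 0"
    using ends(1) by (simp add: st_def hstack_mult_vstack d_def)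
  have "hstack (- S) (mat 1 :: real^'d^'d) *v st (d T) = b"
    using ends(2) by (simp add: st_def hstack_mult_vstack d_def matrix_vector_mult_uminus)
  with T(1) S step start have
    main: "D \<le> C * (norm b + (MAX s\<in>{..<T}. norm (g s) / v (Suc s)))"
    unfolding D_def v_def
    by (intro green[unfolded terminal_green_constant_def, rule_format, of S T "\<lambda>t. st (d t)" g b]) simp
  \<comment> \<open>Four states of norm at most \<open>r\<close>, and two consecutive differences
    whose weights relative to \<open>v (Suc s)\<close> add up to
    \<open>1 + exp (- \<alpha>)\<close>.\<close>
  define \<kappa> where "\<kappa> = I * (CN * (4 * r) * (1 + exp (- \<alpha>)))"
  have "norm (g s) / v (Suc s) \<le> \<kappa> * D" if s: "s < T" for s
  proof -
    have "norm (N (z s, z (Suc s)) - N (y s, y (Suc s))) \<le>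
        CN * (norm (z s) + norm (z (Suc s)) + norm (y s) + norm (y (Suc s))) *
                (norm (z s - y s) + norm (z (Suc s) - y (Suc s)))"
      using residual(1) z(1) y(1) s unfolding residual_constant_def by auto
    also have "\<dots> \<le> CN * (4 * r) * (D * v s + D * v (Suc s))"
      using z(2)[of s] z(2)[of "Suc s"] y(2)[of s] y(2)[of "Suc s"] dD[of s] dD[of "Suc s"] s residual(2) r
      by (intro mult_mono mult_left_mono) (auto simp: d_def)
    also have "v s = exp (- \<alpha>) * v (Suc s)"
      by (simp add: v_def ter_weight_def mult_exp_exp algebra_simps)
    finally have "I * norm (N (z s, z (Suc s)) - N (y s, y (Suc s)))
        \<le> I * (CN * (4 * r) * (D * (exp (- \<alpha>) * v (Suc s)) + D * v (Suc s)))"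
      by (rule mult_left_mono[OF _ I])
    moreover have "norm (g s) \<le> I * norm (N (z s, z (Suc s)) - N (y s, y (Suc s)))"
      using norm_matrix_vector_le_opnorm[of "matrix_inv L1" "st (L (d s, d (Suc s)))"] eqn[OF s]
      by (simp add: g_def I_def st_norm d_def norm_minus_commute)
    ultimately have "norm (g s) \<le> \<kappa> * D * v (Suc s)"
      by (simp add: \<kappa>_def algebra_simps)
    then show ?thesis using v by (simp add: pos_divide_le_eq)
  qed
  then have G: "(MAX s\<in>{..<T}. norm (g s) / v (Suc s)) \<le> \<kappa> * D"
    using T(2) by (subst Max_le_iff) auto
  have "norm (g 0) / v (Suc 0) \<le> (MAX s\<in>{..<T}. norm (g s) / v (Suc s))"
    using T(2) by (intro Max_ge) auto
  then have G0: "0 \<le> (MAX s\<in>{..<T}. norm (g s) / v (Suc s))"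
    using v[of "Suc 0"] by (meson divide_nonneg_pos norm_ge_zero order_trans)
  \<comment> \<open>No sign of \<open>C\<close> is assumed. A negative \<open>C\<close> forces
    \<open>D \<le> 0\<close>; otherwise \<open>\<theta> < 1\<close> absorbs the residual.\<close>
  have "D \<le> \<bar>C\<bar> / (1 - \<theta>) * norm b"
  proof (cases "0 \<le> C")
    case True
    have "D \<le> C * (norm b + \<kappa> * D)"
      using main G True by (meson add_left_mono mult_left_mono order_trans)
    also have "\<dots> = C * norm b + \<theta> * D"
      by (simp add: \<theta>(1) \<kappa>_def I_def algebra_simps)
    finally show ?thesis using True \<theta>(2) by (simp add: field_simps)
  next
    case False
    then have "D \<le> 0"
      using main G0 by (smt (verit) mult_nonpos_nonneg norm_ge_zero)
    also have "0 \<le> \<bar>C\<bar> / (1 - \<theta>) * norm b" using \<theta>(2) by simp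
    finally show ?thesis .
  qed
  then show ?thesis
    using dD[OF t] v[of t] by (smt (verit) d_def v_def mult_right_mono)
qed

section \<open>The stationary objective\<close>

text \<open>\<open>G - G'\<close> is constant near \<open>f x\<close> up to an error of smaller
  order, and a Lipschitz estimate of \<open>f\<close> at \<open>x\<close> preserves that order under
  composition, even if \<open>f\<close> has no derivative.\<close>

lemma has_derivative_zero_remainder:
  assumes G: "(G has_derivative G') (at (f x))" and S: "open S" "x \<in> S"
    and lip: "\<And>y. y \<in> S \<Longrightarrow> norm (f y - f x) \<le> C * norm (y - x)"
  shows "((\<lambda>y. G (f y) - G' (f y)) has_derivative (\<lambda>_. 0)) (at x)"
  unfolding has_derivative_at_alt
proof safe
  show "bounded_linear (\<lambda>_. 0)" by simp
  fix e :: real assume e: "0 < e"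
  \<comment> \<open>Made positive, because it is divided by and \<open>C\<close> has no assumed
    sign.\<close>
  define C' where "C' = \<bar>C\<bar> + 1"
  have C': "0 < C'" by (simp add: C'_def)
  have lin: "linear G'" using G has_derivative_linear by blast
  from e C' have "0 < e / C'" by simp
  then obtain d where d: "0 < d"
    "\<And>w. norm (w - f x) < d \<Longrightarrow> norm (G w - G (f x) - G' (w - f x)) \<le> e / C' * norm (w - f x)"
    using G unfolding has_derivative_at_alt by blast
  obtain r where r: "0 < r" "ball x r \<subseteq> S"
    using S open_contains_ball by blast
  show "\<exists>d>0. \<forall>y. norm (y - x) < d \<longrightarrow>
      norm (G (f y) - G' (f y) - (G (f x) - G' (f x)) - 0) \<le> e * norm (y - x)"
  proof (intro exI[of _ "min r (d / C')"] conjI allI impI)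
    show "0 < min r (d / C')" using r d C' by simp
    fix y assume y: "norm (y - x) < min r (d / C')"
    then have "y \<in> S" using r by (auto simp: dist_norm norm_minus_commute)
    from lip[OF this] have l: "norm (f y - f x) \<le> C' * norm (y - x)"
      unfolding C'_def by (smt (verit, ccfv_SIG) mult_right_mono norm_ge_zero)
    also have "\<dots> < d" using y C' by (simp add: field_simps)
    finally have "norm (G (f y) - G (f x) - G' (f y - f x)) \<le> e / C' * norm (f y - f x)" by (rule d)
    also have "\<dots> \<le> e / C' * (C' * norm (y - x))"
      using l e C' by (intro mult_left_mono) auto
    finally show "norm (G (f y) - G' (f y) - (G (f x) - G' (f x)) - 0) \<le> e * norm (y - x)"
      using C' by (simp add: linear_diff[OF lin] algebra_simps)
  qed
qed

text \<open>With the costates frozen at \<open>x\<close>, the objective is the Lagrangian.  Its derivative in the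
  trajectory vanishes except in the initial state, so Lipschitz dependence of the trajectory on
  \<open>x\<close> suffices and no derivative of the branch is needed.\<close>

lemma GDERIV_stationary_objective:
  fixes F :: "real^'d \<Rightarrow> real^'m \<Rightarrow> real^'d"
  assumes S: "open S" "x \<in> S"
    and dyn: "\<And>y. y \<in> S \<Longrightarrow> X y 0 = y"
      "\<And>y t. y \<in> S \<Longrightarrow> t < T \<Longrightarrow> X y (Suc t) = F (X y t) (v y t)"
    and lip: "\<And>y t. y \<in> S \<Longrightarrow> t \<le> T \<Longrightarrow> norm (X y t - X x t) \<le> C * norm (y - x)"
      "\<And>y t. y \<in> S \<Longrightarrow> t < T \<Longrightarrow> norm (v y t - v x t) \<le> C * norm (y - x)"
    and diff: "\<And>t. t < T \<Longrightarrow> (\<lambda>(x, v). F x v) differentiable (at (X x t, v x t))"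
      "\<And>t. t < T \<Longrightarrow> (\<lambda>(x, v). l x v) differentiable (at (X x t, v x t))"
      "\<rho> differentiable (at (X x T))"
    and costate: "\<And>t. t < T \<Longrightarrow> p t = ham_x F l lam (X x t) (v x t) (p (Suc t))"
      "\<And>t. t < T \<Longrightarrow> ham_u F l lam (X x t) (v x t) (p (Suc t)) = 0"
      "p T = grad \<rho> (X x T)"
  shows "GDERIV (\<lambda>y. \<rho> (X y T) - lam * (\<Sum>t<T. l (X y t) (v y t))) x :> p 0"
proof -
  \<comment> \<open>One time step of the Lagrangian; \<open>p\<close> belongs to the trajectory from
    \<open>x\<close> and does not move with \<open>y\<close>.\<close>
  define g where "g = (\<lambda>t y. ham F l lam (X y t) (v y t) (p (Suc t)) - p t \<bullet> X y t)"
  have g: "(g t has_derivative (\<lambda>_. 0)) (at x)" if t: "t < T" for t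
  proof -
    have "((\<lambda>(x, v). ham F l lam x v (p (Suc t))) has_derivative (\<lambda>h. p t \<bullet> fst h)) (at (X x t, v x t))"
      using has_derivative_ham(1)[OF diff(1,2)[OF t], of lam "p (Suc t)"] costate(1,2)[OF t] by simp
    then have "((\<lambda>y. (\<lambda>(x, v). ham F l lam x v (p (Suc t))) (X y t, v y t) - p t \<bullet> fst (X y t, v y t))
        has_derivative (\<lambda>_. 0)) (at x)"
    proof (rule has_derivative_zero_remainder[where f = "\<lambda>y. (X y t, v y t)", OF _ S])
      fix y assume y: "y \<in> S"
      have "norm ((X y t, v y t) - (X x t, v x t)) \<le> norm (X y t - X x t) + norm (v y t - v x t)"
        by (simp add: norm_Pair_le)
      also have "\<dots> \<le> (C + C) * norm (y - x)"
        using lip(1)[OF y, of t] lip(2)[OF y t] t by (simp add: distrib_right)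
      finally show "norm ((X y t, v y t) - (X x t, v x t)) \<le> (C + C) * norm (y - x)" .
    qed
    then show ?thesis by (simp add: g_def)
  qed
  have "(\<rho> has_derivative (\<lambda>h. p T \<bullet> h)) (at (X x T))"
    using GDERIV_riesz[OF diff(3)] grad_eq_riesz[OF diff(3)] costate(3)
    by (simp add: gderiv_def inner_commute)
  then have gT: "((\<lambda>y. \<rho> (X y T) - p T \<bullet> X y T) has_derivative (\<lambda>_. 0)) (at x)"
    by (rule has_derivative_zero_remainder[OF _ S]) (rule lip(1), auto)
  \<comment> \<open>The dynamics turn \<open>F\<close> into the next state, so the costate terms
    telescope and \<open>p 0 \<bullet> y\<close> alone keeps a first-order part.\<close>
  have eq: "(\<Sum>t<T. g t y) + (\<rho> (X y T) - p T \<bullet> X y T) + p 0 \<bullet> y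
      = \<rho> (X y T) - lam * (\<Sum>t<T. l (X y t) (v y t))" if y: "y \<in> S" for y
  proof -
    have "(\<Sum>t<T. g t y) = (\<Sum>t<T. - lam * l (X y t) (v y t) + (p (Suc t) \<bullet> X y (Suc t) - p t \<bullet> X y t))"
      using dyn(2)[OF y] by (intro sum.cong) (auto simp: g_def ham_def)
    also have "\<dots> = - lam * (\<Sum>t<T. l (X y t) (v y t)) + (p T \<bullet> X y T - p 0 \<bullet> y)"
      unfolding sum.distrib sum_lessThan_telescope[of "\<lambda>t. p t \<bullet> X y t"]
      using dyn(1)[OF y] by (simp add: sum_distrib_left sum_negf)
    finally show ?thesis by simp
  qed
  have "((\<lambda>y. (\<Sum>t<T. g t y) + (\<rho> (X y T) - p T \<bullet> X y T) + p 0 \<bullet> y) has_derivative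
      (\<lambda>h. (\<Sum>t<T. 0) + 0 + p 0 \<bullet> h)) (at x)"
    by (intro has_derivative_add has_derivative_sum g gT) (auto intro!: derivative_eq_intros)
  then have "((\<lambda>y. (\<Sum>t<T. g t y) + (\<rho> (X y T) - p T \<bullet> X y T) + p 0 \<bullet> y) has_derivative
      (\<lambda>h. h \<bullet> p 0)) (at x)"
    by (simp add: inner_commute)
  from has_derivative_transform_within_open[OF this S eq] show ?thesis
    by (simp add: gderiv_def)
qed


section \<open>Terminal sensitivity of local branches\<close>

theorem theorem5p5:
  fixes F :: "real^'d \<Rightarrow> real^'m \<Rightarrow> real^'d"
    and l :: "real^'d \<Rightarrow> real^'m \<Rightarrow> real"
    and lam :: real
    and U U0 V :: "(real^'m) set"
    and xinf pinf :: "real^'d" and uinf :: "real^'m"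
    and W :: "((real^'d) \<times> (real^'m)) set"
    and \<Omega> tube :: "((real^'d) \<times> (real^'d)) set"
    and nu :: "(real^'d) \<times> (real^'d) \<Rightarrow> real^'m"
    and rx rp :: real
    and Ft L N :: "((real^'d) \<times> (real^'d)) \<times> ((real^'d) \<times> (real^'d)) \<Rightarrow> (real^'d) \<times> (real^'d)"
    and L0 L1 M :: "real^('d + 'd)^('d + 'd)"
    and Xs Ps Xu Pu Ds Du Sstar :: "real^'d^'d"
    and Vs Vu :: "real^'d^('d + 'd)"
    and K \<gamma> \<alpha> \<alpha>ter \<eta> GGamma CX CN Cto CG Mter a R \<delta> :: real
    and T0 :: nat
    and Rewards :: "(real^'d \<Rightarrow> real) set"
    and \<X> X0 O\<rho> :: "(real^'d) set"
    and z :: "(real^'d \<Rightarrow> real) \<Rightarrow> nat \<Rightarrow> real^'d \<Rightarrow> nat \<Rightarrow> (real^'d) \<times> (real^'d)"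
    and u :: "(real^'d \<Rightarrow> real) \<Rightarrow> nat \<Rightarrow> real^'d \<Rightarrow> nat \<Rightarrow> real^'m"
    and \<K> :: "(real^'d \<Rightarrow> real) \<Rightarrow> nat \<Rightarrow> real^'d \<Rightarrow> real^'m"
    and \<S> :: "(real^'d \<Rightarrow> real) \<Rightarrow> nat \<Rightarrow> real^'d \<Rightarrow> real"
  assumes U: "compact U" "convex U" and lam: "lam > 0"
    and ref: "xinf = F xinf uinf" "pinf = ham_x F l lam xinf uinf pinf"
      "ham_u F l lam xinf uinf pinf = 0" "uinf \<in> interior U"
      "det (ham_uu F l lam xinf uinf pinf) \<noteq> 0"
    and smooth: "open W" "(xinf, uinf) \<in> W" "C3_on W (\<lambda>(x, v). F x v)" "C3_on W (\<lambda>(x, v). l x v)"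
    and nbhds: "open \<Omega>" "(xinf, pinf) \<in> \<Omega>" "open V" "uinf \<in> V"
      "compact (closure V)" "closure V \<subseteq> interior U" "fst ` \<Omega> \<times> V \<subseteq> W"
    and nu: "C2_on \<Omega> nu" "nu ` \<Omega> \<subseteq> V" "\<forall>(x, p)\<in>\<Omega>. ham_u F l lam x (nu (x, p)) p = 0"
      "nu (xinf, pinf) = uinf"
    and nu_unique: "\<forall>nu'. C2_on \<Omega> nu' \<and> nu' ` \<Omega> \<subseteq> V \<and>
        (\<forall>(x, p)\<in>\<Omega>. ham_u F l lam x (nu' (x, p)) p = 0) \<and> nu' (xinf, pinf) = uinf
        \<longrightarrow> (\<forall>w\<in>\<Omega>. nu' w = nu w)"
    and Ft: "Ft = (\<lambda>(w, w'). opt_map F l lam nu ((xinf, pinf) + w, (xinf, pinf) + w'))"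
    and L: "L = frechet_derivative Ft (at (0, 0))"
    and N: "N = (\<lambda>w. Ft w - L w)"
    and L0: "L0 = pair_matrix (\<lambda>h. L (h, 0))" and L1: "L1 = pair_matrix (\<lambda>h. L (0, h))"
    and tube: "rx > 0" "rp > 0" "tube = cball 0 rx \<times> cball 0 rp"
      "(\<lambda>w. (xinf, pinf) + w) ` tube \<subseteq> \<Omega>"
    and U0: "convex U0" "compact (closure U0)" "closure U0 \<subseteq> interior U"
      "\<forall>w\<in>tube. nu ((xinf, pinf) + w) \<in> U0"
    and tube_bounds: "\<exists>B. \<forall>w\<in>tube. norm (Dop nu ((xinf, pinf) + w)) \<le> B \<and>
        norm (Dop (Dop nu) ((xinf, pinf) + w)) \<le> B"
      "\<exists>B. \<forall>w\<in>tube \<times> tube. norm (Dop (Dop Ft) w) \<le> B"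
    and CN: "residual_constant tube N CN"
    and L1_det: "det L1 \<noteq> 0" and M: "M = - (matrix_inv L1 ** L0)"
    and hyp: "hyperbolic M" "dim (stable_subspace M) = CARD('d)" "dim (unstable_subspace M) = CARD('d)"
    and Vs: "Vs = vstack Xs Ps" "columns_basis Vs (stable_subspace M)" "M ** Vs = Vs ** Ds"
    and Vu: "Vu = vstack Xu Pu" "columns_basis Vu (unstable_subspace M)" "M ** Vu = Vu ** Du"
    and decay: "K \<ge> 1" "\<gamma> > 0" "\<forall>k. opnorm (Vs ** matpow Ds k) \<le> K * exp (- \<gamma> * real k)"
      "\<forall>k. opnorm (Vu ** matpow (matrix_inv Du) k) \<le> K * exp (- \<gamma> * real k)"
    and T0: "T0 \<ge> 1"
    and Xs: "invertible Xs"
    and Gamma: "\<forall>T\<ge>T0. invertible (Gamma_hat Xs Ps Xu Pu Ds Du T Sstar)"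
      "\<exists>B. \<forall>T\<ge>T0. opnorm (matrix_inv (Gamma_hat Xs Ps Xu Pu Ds Du T Sstar)) \<le> B"
    and GGamma: "GGamma = (SUP T\<in>{T0..}. opnorm (matrix_inv (Gamma_hat Xs Ps Xu Pu Ds Du T Sstar)))"
    and CX: "CX = (SUP T\<in>{T0..}. opnorm (hstack (Xs ** matpow Ds T) Xu))"
    and small: "GGamma * CX * \<eta> < 1"
    and \<alpha>ter: "0 < \<alpha>ter" "\<alpha>ter < \<gamma>"
    and Cto: "terminal_green_constant M Sstar \<eta> \<alpha>ter T0 Cto"
    and \<X>: "convex \<X>" "xinf \<in> interior \<X>"
    and O\<rho>: "open O\<rho>" "(\<lambda>\<xi>. xinf + \<xi>) ` cball 0 rx \<union> \<X> \<subseteq> O\<rho>"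
    and Rewards: "\<forall>\<rho>\<in>Rewards. C3_on O\<rho> \<rho> \<and> (\<forall>x\<in>O\<rho>. norm (Dop \<rho> x) \<le> Mter \<and>
        norm (Dop (Dop \<rho>) x) \<le> Mter \<and> norm (Dop (Dop (Dop \<rho>)) x) \<le> Mter)"
    and hess_close: "\<forall>\<rho>\<in>Rewards. \<forall>x\<in>\<X>. opnorm (hess \<rho> x - Sstar) \<le> \<eta>"
    and Green: "\<forall>\<rho>\<in>Rewards.
        uniform_green L (frechet_derivative (endpoint_map xinf \<rho>) (at (0, 0))) \<gamma> T0 CG"
    and \<alpha>: "0 < \<alpha>" "\<alpha> < \<gamma> / 2"
    and a: "a = 2 * CG * conv_constant \<gamma> \<alpha> * CN * (1 + exp \<alpha>)\<^sup>2 + 16 * CG * Mter"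
    and R: "R > 0" "2 * a * R < 1"
      "\<forall>T\<ge>T0. \<forall>y :: nat \<Rightarrow> (real^'d) \<times> (real^'d). wnorm \<alpha> T y \<le> R \<longrightarrow> (\<forall>t\<le>T. y t \<in> tube)"
    and \<delta>: "\<delta> = (R - a * R\<^sup>2) / CG"
    and \<theta>: "8 * Cto * opnorm (matrix_inv L1) * CN * (1 + exp (- \<alpha>ter)) * R < 1"
    and X0: "xinf \<in> interior X0"
      "\<forall>x\<in>X0. \<forall>\<rho>\<in>Rewards. norm (x - xinf, grad \<rho> xinf - pinf) < \<delta>"
    and terminal: "\<forall>\<rho>\<in>Rewards. \<forall>x\<in>X0. \<forall>T\<ge>T0. \<forall>y.
        is_branch F l lam nu xinf pinf \<alpha> R \<rho> T x y \<longrightarrow> branch_x xinf y T \<in> \<X>"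
    and z: "z = local_branch F l lam nu xinf pinf \<alpha> R"
    and u: "u = (\<lambda>\<rho> T x. branch_u nu xinf pinf (z \<rho> T x))"
    and \<K>: "\<K> = (\<lambda>\<rho> T x. u \<rho> T x 0)"
    and \<S>: "\<S> = (\<lambda>\<rho> T x. stationary_objective l lam nu xinf pinf \<rho> T (z \<rho> T x))"
  shows "(\<forall>\<rho>\<in>Rewards. \<forall>x\<in>X0. \<forall>T\<ge>T0.
            is_branch F l lam nu xinf pinf \<alpha> R \<rho> T x (z \<rho> T x) \<and>
            (\<forall>y. is_branch F l lam nu xinf pinf \<alpha> R \<rho> T x y \<longrightarrow> (\<forall>t\<le>T. y t = z \<rho> T x t)) \<and>
            (GDERIV (\<S> \<rho> T) x :> branch_p pinf (z \<rho> T x) 0))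
    \<and> (\<exists>Cter. \<forall>x\<in>X0. \<forall>\<rho>\<in>Rewards. \<forall>\<sigma>\<in>Rewards. \<forall>T\<ge>T0.
          (\<forall>t<T. ennreal (norm (z \<rho> T x t - z \<sigma> T x t) + norm (u \<rho> T x t - u \<sigma> T x t))
              \<le> ennreal (Cter * exp (- \<alpha>ter * (real T - real t))) * sup_norm \<X> (grad (\<lambda>y. \<rho> y - \<sigma> y))) \<and>
          ennreal (norm (\<K> \<rho> T x - \<K> \<sigma> T x))
              \<le> ennreal (Cter * exp (- \<alpha>ter * real T)) * C2_norm \<X> (\<lambda>y. \<rho> y - \<sigma> y) \<and>
          ennreal (norm (grad (\<S> \<rho> T) x - grad (\<S> \<sigma> T) x))
              \<le> ennreal (Cter * exp (- \<alpha>ter * real T)) * sup_norm \<X> (grad (\<lambda>y. \<rho> y - \<sigma> y)) \<and>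
          ennreal (norm (grad (\<S> \<rho> T) x - grad (\<S> \<sigma> T) x))
              \<le> ennreal (Cter * exp (- \<alpha>ter * real T)) * C2_norm \<X> (\<lambda>y. \<rho> y - \<sigma> y))"
proof -
  define B where "B = (\<lambda>\<rho>. frechet_derivative (endpoint_map xinf \<rho>) (at (0, 0)))"
  define E where "E = (\<lambda>\<rho> w. endpoint_map xinf \<rho> w - B \<rho> w)"
  define datum where "datum = (\<lambda>\<rho> y. (y - xinf, grad \<rho> xinf - pinf))"
  define branch where "branch = is_branch F l lam nu xinf pinf \<alpha> R"
  have fst_le: "norm (fst w) \<le> norm w" and snd_le: "norm (snd w) \<le> norm w"
    for w :: "(real^'d) \<times> (real^'d)"
    using norm_fst_le[of "fst w" "snd w"] norm_snd_le[of "snd w" "fst w"] by simp_all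
  have zero_tube: "(0, 0) \<in> tube" using tube by simp
  \<comment> \<open>The control reads the state at one time and the costate at the next. The tube is
    a product of balls, so the mixed pair stays in it.\<close>
  have mixed: "(xinf + fst w, pinf + snd w') \<in> \<Omega>" if "w \<in> tube" "w' \<in> tube" for w w'
  proof -
    have "(fst w, snd w') \<in> tube" using that tube(3) by auto
    then show ?thesis using tube(4) by force
  qed
  have C2: "C2_on W (\<lambda>(x, v). F x v)" "C2_on W (\<lambda>(x, v). l x v)"
    using smooth by (auto simp: C3_on_def C2_on_def)
  have diff: "(\<lambda>(x, v). F x v) differentiable (at (x, nu (x, p)))"
    "(\<lambda>(x, v). l x v) differentiable (at (x, nu (x, p)))" if "(x, p) \<in> \<Omega>" for x p
  proof -
    have "(x, nu (x, p)) \<in> W" using that nbhds(7) nu(2) by force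
    then show "(\<lambda>(x, v). F x v) differentiable (at (x, nu (x, p)))"
      "(\<lambda>(x, v). l x v) differentiable (at (x, nu (x, p)))"
      using C2 by (auto simp: C2_on_def C1_on_def)
  qed
  have linL: "linear L"
  proof -
    have "fst ` \<Omega> \<times> nu ` \<Omega> \<subseteq> W"
      using nbhds(7) nu(2) by (meson Sigma_mono order_refl order_trans)
    moreover have "C1_on \<Omega> nu" using nu(1) by (simp add: C2_on_def)
    ultimately have "opt_map F l lam nu differentiable (at ((xinf, pinf), (xinf, pinf)))"
      by (intro differentiable_opt_map[OF smooth(1) C2 nbhds(1,2)])
    then have d: "opt_map F l lam nu differentiable (at ((\<lambda>w. ((xinf, pinf), (xinf, pinf)) + w) (0, 0)))"
      by (simp add: zero_prod_def)
    have "(\<lambda>w. ((xinf, pinf), (xinf, pinf)) + w) differentiable (at (0, 0))"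
      by (intro differentiable_add differentiable_const) simp
    from differentiable_compose[OF d this]
    have "Ft differentiable (at (0, 0))"
      unfolding Ft split_beta by (simp add: plus_prod_def)
    then show ?thesis unfolding L by (rule linear_frechet_derivative)
  qed

  \<comment> \<open>Signs of the constants\<close>
  have CN0: "0 \<le> CN"
  proof -
    \<comment> \<open>A nonzero point of the tube: the residual bound there has a positive factor
      next to \<open>CN\<close>.\<close>
    define e :: "real^'d" where "e = rx *\<^sub>R axis undefined 1"
    have e: "norm e = rx" using tube(1) by (simp add: e_def norm_axis_1)
    then have "(e, 0) \<in> tube" using tube by simp
    with CN zero_tube have "norm (N ((e, 0), (0, 0))) \<le> CN * (norm (e, 0 :: real^'d) + norm (0 :: real^'d, 0 :: real^'d))\<^sup>2"
      unfolding residual_constant_def by blast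
    from order_trans[OF norm_ge_zero this] have "0 \<le> CN * rx\<^sup>2"
      using e by (simp add: norm_Pair)
    then show ?thesis using tube(1) by (simp add: zero_le_mult_iff)
  qed
  have rewards_C3: "C3_on O\<rho> \<rho>" "C2_on O\<rho> \<rho>"
    and rewards_diff: "\<And>x. x \<in> O\<rho> \<Longrightarrow> \<rho> differentiable (at x)" if "\<rho> \<in> Rewards" for \<rho>
    using Rewards that by (auto simp: C3_on_def C2_on_def C1_on_def)
  have cball_O: "cball xinf rx \<subseteq> O\<rho>"
  proof
    fix y assume "y \<in> cball xinf rx"
    then have "y = xinf + (y - xinf)" "y - xinf \<in> cball 0 rx"
      by (auto simp: dist_norm norm_minus_commute)
    then show "y \<in> O\<rho>" using O\<rho>(2) by blast
  qed
  have Mter0: "0 \<le> Mter" if "\<rho> \<in> Rewards" for \<rho>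
  proof -
    have "xinf \<in> O\<rho>" using cball_O tube(1) by auto
    with Rewards that have "norm (Dop \<rho> xinf) \<le> Mter" by blast
    from order_trans[OF norm_ge_zero this] show ?thesis .
  qed
  have CG0: "0 \<le> CG" if "\<rho> \<in> Rewards" for \<rho>
  proof -
    \<comment> \<open>A nonzero datum with zero forcing leaves \<open>CG\<close> times a positive
      number as an upper bound for a norm.\<close>
    define b :: "(real^'d) \<times> (real^'d)" where "b = (axis undefined 1, 0)"
    have b: "norm b = 1" by (simp add: b_def norm_axis_1 norm_Pair)
    have green: "uniform_green L (B \<rho>) \<gamma> T0 CG" using Green that by (simp add: B_def)
    have "\<exists>h. (\<forall>t<T0. L (h t, h (Suc t)) = 0) \<and> B \<rho> (h 0, h T0) = b"
      and bnd: "\<forall>h. (\<forall>t<T0. L (h t, h (Suc t)) = 0) \<and> B \<rho> (h 0, h T0) = b \<longrightarrow> (\<forall>t\<le>T0.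
           norm (h t) \<le> CG * ((exp (- \<gamma> * real t) + exp (- \<gamma> * (real T0 - real t))) * norm b
                            + (\<Sum>s<T0. green_kernel \<gamma> T0 t s * norm (0 :: (real^'d) \<times> (real^'d)))))"
      using green[unfolded uniform_green_def Let_def, THEN spec, THEN mp, OF order_refl,
          THEN spec[of _ "\<lambda>_. 0"], THEN spec[of _ b]]
      by blast+
    then obtain h where h: "(\<forall>t<T0. L (h t, h (Suc t)) = 0) \<and> B \<rho> (h 0, h T0) = b" by blast
    have "norm (h 0) \<le> CG * ((exp (- \<gamma> * real 0) + exp (- \<gamma> * (real T0 - real 0))) * norm b
                            + (\<Sum>s<T0. green_kernel \<gamma> T0 0 s * norm (0 :: (real^'d) \<times> (real^'d))))"
      using bnd[rule_format, OF h, of 0] by simp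
    from order_trans[OF norm_ge_zero this] have "0 \<le> CG * (1 + exp (- \<gamma> * real T0))"
      using b by simp
    moreover have "0 < 1 + exp (- \<gamma> * real T0)" by (simp add: add_pos_pos)
    ultimately show ?thesis by (metis mult_neg_pos not_le)
  qed

  \<comment> \<open>Branches as solutions of the boundary value problem\<close>
  have bvp: "weighted_bvp L N (B \<rho>) (E \<rho>) tube \<gamma> \<alpha> CG CN Mter R T0 T" if \<rho>: "\<rho> \<in> Rewards" and "T0 \<le> T" for \<rho> T
  proof -
    note ep = endpoint_residual_lipschitz[OF O\<rho>(1) rewards_C3(1)[OF \<rho>] cball_O less_imp_le[OF tube(1)],
        where M = Mter and B = "B \<rho>" and E = "E \<rho>"]
    have third: "norm (Dop (Dop (Dop \<rho>)) x) \<le> Mter" if "x \<in> O\<rho>" for x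
      using Rewards \<rho> that by blast
    note ep = ep[OF third Mter0[OF \<rho>] fun_cong[OF B_def] fun_cong[OF E_def]]
    show ?thesis
    proof (rule weighted_bvp.intro)
      show "norm (E \<rho> (v, w) - E \<rho> (v', w')) \<le> Mter * (norm w + norm w') * norm (w - w')"
        if "w \<in> tube" "w' \<in> tube" for v w v' w'
        using that tube(3) by (intro ep(3)) auto
      show "y t \<in> tube" if "wnorm \<alpha> T y \<le> R" "t \<le> T" for y t
        using R(3) \<open>T0 \<le> T\<close> that by blast
      show "uniform_green L (B \<rho>) \<gamma> T0 CG" using Green \<rho> by (simp add: B_def)
    qed (use linL ep(1,2) that CG0 CN0 Mter0 R \<alpha> CN in auto)
  qed
  have rate: "weighted_bvp.rate \<gamma> \<alpha> CG CN Mter = a" if "\<rho> \<in> Rewards" for \<rho>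
    using weighted_bvp.rate_def[OF bvp[OF that order_refl]] a by simp
  \<comment> \<open>In the weighted ball the sequence stays in the tube, where \<open>nu\<close>
    makes \<open>ham_u\<close> vanish. What remains of the branch conditions is
    \<open>Ft = 0\<close> together with the endpoint rows.\<close>
  have branch_iff: "branch \<rho> T y w \<longleftrightarrow>
      wnorm \<alpha> T w \<le> R \<and> weighted_bvp.solves L N (B \<rho>) (E \<rho>) T (datum \<rho> y) w"
    if \<rho>: "\<rho> \<in> Rewards" and T: "T0 \<le> T" for \<rho> T y w
  proof (cases "wnorm \<alpha> T w \<le> R")
    case True
    then have w: "w t \<in> tube" if "t \<le> T" for t using R(3) T that by blast
    have stationary: "ham_u F l lam (xinf + fst (w t)) (nu (xinf + fst (w t), pinf + snd (w (Suc t))))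
        (pinf + snd (w (Suc t))) = 0" if "t < T" for t
      using mixed[OF w w, of t "Suc t"] nu(3) that by auto
    have Ft0: "L (w t, w (Suc t)) = - N (w t, w (Suc t)) \<longleftrightarrow> Ft (w t, w (Suc t)) = 0" for t
      by (simp add: N eq_neg_iff_add_eq_0)
    have E0: "B \<rho> (w 0, w T) = datum \<rho> y - E \<rho> (w 0, w T) \<longleftrightarrow> endpoint_map xinf \<rho> (w 0, w T) = datum \<rho> y"
      by (auto simp: E_def)
    have "endpoint_map xinf \<rho> (w 0, w T) = datum \<rho> y \<longleftrightarrow>
        xinf + fst (w 0) = y \<and> pinf + snd (w T) = grad \<rho> (xinf + fst (w T))"
      by (auto simp: endpoint_map_def datum_def split_beta algebra_simps)
    moreover have "Ft (w t, w (Suc t)) = 0 \<longleftrightarrow>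
        xinf + fst (w (Suc t)) = F (xinf + fst (w t)) (nu (xinf + fst (w t), pinf + snd (w (Suc t)))) \<and>
        pinf + snd (w t) = ham_x F l lam (xinf + fst (w t))
          (nu (xinf + fst (w t), pinf + snd (w (Suc t)))) (pinf + snd (w (Suc t)))" for t
      by (simp add: Ft opt_map_def split_beta zero_prod_def)
    ultimately show ?thesis
      unfolding branch_def is_branch_def Let_def weighted_bvp.solves_def[OF bvp[OF \<rho> T]] Ft0 E0
        branch_x_def branch_p_def branch_u_def
      using True stationary by auto
  next
    case False
    then show ?thesis by (simp add: branch_def is_branch_def Let_def)
  qed

  \<comment> \<open>Existence and Lipschitz dependence on the initial state\<close>
  define D where "D = (\<lambda>\<rho>. {y. norm (datum \<rho> y) < \<delta>})"
  \<comment> \<open>\<open>X0\<close> need not be open, but a derivative at its points needs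
    branches nearby. Smallness of the datum is all that existence uses, and it is an open
    condition.\<close>
  have D_open: "open (D \<rho>)" for \<rho>
    unfolding D_def datum_def by (intro open_Collect_less continuous_intros)
  have X0_D: "x \<in> D \<rho>" if "x \<in> X0" "\<rho> \<in> Rewards" for x \<rho>
    using X0(2) that by (simp add: D_def datum_def)
  have z_branch: "branch \<rho> T y (z \<rho> T y)" if \<rho>: "\<rho> \<in> Rewards" and T: "T0 \<le> T" and y: "y \<in> D \<rho>" for \<rho> T y
  proof -
    have less: "norm (datum \<rho> y) < \<delta>" using y by (simp add: D_def)
    \<comment> \<open>For \<open>CG = 0\<close> the quotient defining \<delta> is 0, and no datum
      has norm below it.\<close>
    then have "CG \<noteq> 0" using \<delta> norm_ge_zero[of "datum \<rho> y"] by auto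
    with CG0[OF \<rho>] have "0 < CG" by simp
    with less have "CG * norm (datum \<rho> y) + a * R\<^sup>2 \<le> R"
      by (simp add: \<delta> field_simps)
    then have "\<exists>w. branch \<rho> T y w"
      unfolding branch_iff[OF \<rho> T]
      by (intro weighted_bvp.solution_exists[OF bvp[OF \<rho> T]]) (use R rate[OF \<rho>] in auto)
    then show ?thesis unfolding z local_branch_def branch_def by (rule someI_ex)
  qed
  \<comment> \<open>The trailing 2 bounds the two-sided weight, so the constant does not depend on
    the horizon.\<close>
  define Lip where "Lip = CG / (1 - 2 * a * R) * 2"
  have lipschitz: "norm (w t - w' t) \<le> Lip * norm (y - y')"
    if \<rho>: "\<rho> \<in> Rewards" and T: "T0 \<le> T" and w: "branch \<rho> T y w" "branch \<rho> T y' w'" and t: "t \<le> T"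
    for \<rho> T y y' w w' t
  proof -
    have "norm (w t - w' t) \<le> CG / (1 - 2 * a * R) * norm (datum \<rho> y - datum \<rho> y') * weight \<alpha> T t"
      using weighted_bvp.solution_lipschitz[OF bvp[OF \<rho> T], of w "datum \<rho> y" w' "datum \<rho> y'" t]
        w R t rate[OF \<rho>] by (simp add: branch_iff[OF \<rho> T])
    also have "\<dots> \<le> CG / (1 - 2 * a * R) * norm (datum \<rho> y - datum \<rho> y') * 2"
      using CG0[OF \<rho>] R \<alpha> t by (intro mult_left_mono weight_le_2) auto
    also have "norm (datum \<rho> y - datum \<rho> y') = norm (y - y')"
      by (simp add: datum_def norm_Pair)
    finally show ?thesis by (simp add: Lip_def mult.commute mult.left_commute)
  qed
  obtain Bnu where Bnu: "\<And>w. w \<in> tube \<Longrightarrow> norm (Dop nu ((xinf, pinf) + w)) \<le> Bnu"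
    using tube_bounds(1) by blast
  have Bnu0: "0 \<le> Bnu" by (rule order_trans[OF norm_ge_zero Bnu[OF zero_tube]])
  have nu_lip: "norm (nu ((xinf, pinf) + w) - nu ((xinf, pinf) + w')) \<le> Bnu * norm (w - w')"
    if "w \<in> tube" "w' \<in> tube" for w w'
  proof (rule differentiable_bound)
    show "convex tube" unfolding tube(3) by (intro convex_Times convex_cball)
    fix v assume v: "v \<in> tube"
    then have "(xinf, pinf) + v \<in> \<Omega>" using tube(4) by blast
    then have d: "(nu has_derivative Dop nu ((xinf, pinf) + v)) (at ((xinf, pinf) + v))"
      using nu(1) by (intro Dop_has_derivative) (auto simp: C2_on_def C1_on_def)
    have "((\<lambda>w. (xinf, pinf) + w) has_derivative (\<lambda>h. h)) (at v)"
      by (auto intro!: derivative_eq_intros)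
    from has_derivative_compose[OF this d]
    show "((\<lambda>w. nu ((xinf, pinf) + w)) has_derivative Dop nu ((xinf, pinf) + v)) (at v within tube)"
      by (rule has_derivative_at_withinI)
    show "onorm (Dop nu ((xinf, pinf) + v)) \<le> Bnu"
      using Bnu[OF v] by (simp add: norm_blinfun.rep_eq)
  qed (use that in auto)
  have in_tube: "w t \<in> tube" if "\<rho> \<in> Rewards" "T0 \<le> T" "branch \<rho> T y w" "t \<le> T" for \<rho> T y w t
    using that R(3) branch_iff by blast
  have u_lip: "norm (branch_u nu xinf pinf w t - branch_u nu xinf pinf w' t)
      \<le> Bnu * (norm (w t - w' t) + norm (w (Suc t) - w' (Suc t)))"
    if "w t \<in> tube" "w (Suc t) \<in> tube" "w' t \<in> tube" "w' (Suc t) \<in> tube" for w w' t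
  proof -
    have "norm (branch_u nu xinf pinf w t - branch_u nu xinf pinf w' t)
        \<le> Bnu * norm ((fst (w t), snd (w (Suc t))) - (fst (w' t), snd (w' (Suc t))))"
      using nu_lip[of "(fst (w t), snd (w (Suc t)))" "(fst (w' t), snd (w' (Suc t)))"] that tube(3)
      by (auto simp: branch_u_def branch_x_def branch_p_def)
    also have "\<dots> \<le> Bnu * (norm (w t - w' t) + norm (w (Suc t) - w' (Suc t)))"
    proof (rule mult_left_mono[OF _ Bnu0])
      have "norm ((fst (w t), snd (w (Suc t))) - (fst (w' t), snd (w' (Suc t))))
          \<le> norm (fst (w t - w' t)) + norm (snd (w (Suc t) - w' (Suc t)))"
        using norm_Pair_le[of "fst (w t - w' t)" "snd (w (Suc t) - w' (Suc t))"] by simp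
      also have "\<dots> \<le> norm (w t - w' t) + norm (w (Suc t) - w' (Suc t))"
        by (intro add_mono) (simp_all only: fst_le snd_le)
      finally show "norm ((fst (w t), snd (w (Suc t))) - (fst (w' t), snd (w' (Suc t))))
          \<le> norm (w t - w' t) + norm (w (Suc t) - w' (Suc t))" .
    qed
    finally show ?thesis .
  qed
  have branchD: "branch_x xinf w (Suc t) = F (branch_x xinf w t) (branch_u nu xinf pinf w t)"
    "branch_p pinf w t = ham_x F l lam (branch_x xinf w t) (branch_u nu xinf pinf w t) (branch_p pinf w (Suc t))"
    "ham_u F l lam (branch_x xinf w t) (branch_u nu xinf pinf w t) (branch_p pinf w (Suc t)) = 0"
    if "branch \<rho> T y w" "t < T" for \<rho> T y w t
    using that by (simp_all add: branch_def is_branch_def Let_def)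
  have branch_ends: "branch_x xinf w 0 = y" "branch_p pinf w T = grad \<rho> (branch_x xinf w T)"
    if "branch \<rho> T y w" for \<rho> T y w
    using that by (simp_all add: branch_def is_branch_def Let_def)

  \<comment> \<open>The objective gradient at an initial state\<close>
  have gradient: "GDERIV (\<S> \<rho> T) x :> branch_p pinf (z \<rho> T x) 0"
    if \<rho>: "\<rho> \<in> Rewards" and T: "T0 \<le> T" and x: "x \<in> X0" for \<rho> T x
  proof -
    have xD: "x \<in> D \<rho>" by (rule X0_D[OF x \<rho>])
    let ?z = "z \<rho> T"
    have zb: "branch \<rho> T y (?z y)" if "y \<in> D \<rho>" for y by (rule z_branch[OF \<rho> T that])
    have zt: "?z y t \<in> tube" if "y \<in> D \<rho>" "t \<le> T" for y t by (rule in_tube[OF \<rho> T zb[OF that(1)] that(2)])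
    have Lip0: "0 \<le> Lip" using CG0[OF \<rho>] R by (simp add: Lip_def)
    have zl: "norm (?z y t - ?z x t) \<le> Lip * norm (y - x)" if "y \<in> D \<rho>" "t \<le> T" for y t
      by (rule lipschitz[OF \<rho> T zb[OF that(1)] zb[OF xD] that(2)])
    have at: "(branch_x xinf (?z x) t, branch_p pinf (?z x) (Suc t)) \<in> \<Omega>" if "t < T" for t
      using mixed[OF zt[OF xD] zt[OF xD], of t "Suc t"] that by (simp add: branch_x_def branch_p_def)
    \<comment> \<open>Covers states by \<open>Lip\<close> and controls by two consecutive states
      through \<open>nu\<close>.\<close>
    define C where "C = Lip + Bnu * (Lip + Lip)"
    have "GDERIV (\<lambda>y. \<rho> (branch_x xinf (?z y) T) - lam * (\<Sum>t<T. l (branch_x xinf (?z y) t)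
        (branch_u nu xinf pinf (?z y) t))) x :> branch_p pinf (?z x) 0"
    proof (rule GDERIV_stationary_objective[where F = F and C = C, OF D_open xD])
      fix y t assume y: "y \<in> D \<rho>"
      show "branch_x xinf (?z y) 0 = y" by (rule branch_ends(1)[OF zb[OF y]])
      show "branch_x xinf (?z y) (Suc t) = F (branch_x xinf (?z y) t) (branch_u nu xinf pinf (?z y) t)"
        if "t < T" by (rule branchD(1)[OF zb[OF y] that])
      show "norm (branch_x xinf (?z y) t - branch_x xinf (?z x) t) \<le> C * norm (y - x)" if t: "t \<le> T"
      proof -
        have "norm (branch_x xinf (?z y) t - branch_x xinf (?z x) t) \<le> norm (?z y t - ?z x t)"
          using fst_le[of "?z y t - ?z x t"] by (simp add: branch_x_def)
        also have "\<dots> \<le> Lip * norm (y - x)" by (rule zl[OF y t])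
        also have "\<dots> \<le> C * norm (y - x)"
          using Lip0 Bnu0 by (intro mult_right_mono) (auto simp: C_def)
        finally show ?thesis .
      qed
      show "norm (branch_u nu xinf pinf (?z y) t - branch_u nu xinf pinf (?z x) t) \<le> C * norm (y - x)"
        if t: "t < T"
      proof -
        have "norm (branch_u nu xinf pinf (?z y) t - branch_u nu xinf pinf (?z x) t)
            \<le> Bnu * (norm (?z y t - ?z x t) + norm (?z y (Suc t) - ?z x (Suc t)))"
          using t y xD by (intro u_lip zt) auto
        also have "\<dots> \<le> Bnu * (Lip * norm (y - x) + Lip * norm (y - x))"
          using t y by (intro mult_left_mono add_mono zl Bnu0) auto
        also have "\<dots> \<le> C * norm (y - x)"
          using Lip0 by (simp add: C_def algebra_simps)
        finally show ?thesis .
      qed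
    next
      fix t assume t: "t < T"
      show "(\<lambda>(x, v). F x v) differentiable (at (branch_x xinf (?z x) t, branch_u nu xinf pinf (?z x) t))"
        "(\<lambda>(x, v). l x v) differentiable (at (branch_x xinf (?z x) t, branch_u nu xinf pinf (?z x) t))"
        unfolding branch_u_def by (intro diff at[OF t])+
      show "branch_p pinf (?z x) t = ham_x F l lam (branch_x xinf (?z x) t)
          (branch_u nu xinf pinf (?z x) t) (branch_p pinf (?z x) (Suc t))"
        "ham_u F l lam (branch_x xinf (?z x) t)
          (branch_u nu xinf pinf (?z x) t) (branch_p pinf (?z x) (Suc t)) = 0"
        by (rule branchD(2,3)[OF zb[OF xD] t])+
    next
      show "\<rho> differentiable (at (branch_x xinf (?z x) T))"
      proof (rule rewards_diff[OF \<rho>])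
        have "norm (fst (?z x T)) \<le> rx" using zt[OF xD, of T] tube(3) by auto
        then have "branch_x xinf (?z x) T \<in> cball xinf rx" by (simp add: branch_x_def dist_norm)
        then show "branch_x xinf (?z x) T \<in> O\<rho>" using cball_O by blast
      qed
      show "branch_p pinf (?z x) T = grad \<rho> (branch_x xinf (?z x) T)"
        by (rule branch_ends(2)[OF zb[OF xD]])
    qed
    then show ?thesis by (simp add: \<S> stationary_objective_def)
  qed

  \<comment> \<open>Comparison of two rewards\<close>
  define \<theta> where "\<theta> = 8 * Cto * opnorm (matrix_inv L1) * CN * (1 + exp (- \<alpha>ter)) * R"
  have \<theta>_less: "\<theta> < 1" unfolding \<theta>_def by (rule \<theta>)
  define Cz where "Cz = \<bar>Cto\<bar> / (1 - \<theta>)"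
  have Cz0: "0 \<le> Cz" using \<theta>_less by (simp add: Cz_def)
  let ?xT = "\<lambda>\<rho> T x. branch_x xinf (z \<rho> T x) T"
  have difference: "norm (z \<rho> T x t - z \<sigma> T x t)
      \<le> Cz * norm (grad (\<lambda>y. \<rho> y - \<sigma> y) (?xT \<sigma> T x)) * ter_weight \<alpha>ter T t"
    and terminal_mem: "?xT \<sigma> T x \<in> \<X>"
    if \<rho>: "\<rho> \<in> Rewards" and \<sigma>: "\<sigma> \<in> Rewards" and T: "T0 \<le> T" and x: "x \<in> X0" and t: "t \<le> T"
    for \<rho> \<sigma> T x t
  proof -
    let ?z = "z \<rho> T x" and ?y = "z \<sigma> T x"
    have zb: "branch \<rho> T x ?z" and yb: "branch \<sigma> T x ?y"
      by (intro z_branch X0_D \<rho> \<sigma> x T)+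
    have zX: "?xT \<rho> T x \<in> \<X>" and yX: "?xT \<sigma> T x \<in> \<X>"
      using terminal \<rho> \<sigma> x T zb yb unfolding branch_def by blast+
    show "?xT \<sigma> T x \<in> \<X>" by (rule yX)
    have "\<X> \<subseteq> O\<rho>" using O\<rho>(2) by auto
    with yX have yO: "?xT \<sigma> T x \<in> O\<rho>" by auto
    let ?d = "?xT \<rho> T x - ?xT \<sigma> T x"
    have \<eta>: "opnorm (hess \<rho> w - Sstar) \<le> \<eta>" if "w \<in> \<X>" for w using hess_close \<rho> that by blast
    have "norm (grad \<rho> (?xT \<rho> T x) - grad \<rho> (?xT \<sigma> T x) - Sstar *v ?d) \<le> \<eta> * norm ?d"
      using \<eta> zX yX by (intro grad_secant_bound[OF O\<rho>(1) rewards_C3(2)[OF \<rho>] \<X>(1) \<open>\<X> \<subseteq> O\<rho>\<close>])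
    moreover have "?d = 0 \<longrightarrow> grad \<rho> (?xT \<rho> T x) - grad \<rho> (?xT \<sigma> T x) = 0" by auto
    moreover have "0 \<le> \<eta>"
    proof -
      have "0 \<le> opnorm (hess \<rho> (?xT \<sigma> T x) - Sstar)"
        unfolding opnorm_def by (intro onorm_pos_le matrix_vector_mul_bounded_linear)
      also have "\<dots> \<le> \<eta>" by (rule \<eta>[OF yX])
      finally show ?thesis .
    qed
    ultimately obtain S where S: "S *v ?d = grad \<rho> (?xT \<rho> T x) - grad \<rho> (?xT \<sigma> T x)"
      "opnorm (S - Sstar) \<le> \<eta>"
      by (rule secant_matrix)
    \<comment> \<open>The terminal costates differ by the increment of \<open>grad \<rho>\<close>
      between the two terminal states, which is \<open>S *v ?d\<close>, plus the gap between
      \<open>grad \<rho>\<close> and \<open>grad \<sigma>\<close> at the terminal state of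
      \<sigma>.\<close>
    let ?b = "grad (\<lambda>y. \<rho> y - \<sigma> y) (?xT \<sigma> T x)"
    have b: "?b = grad \<rho> (?xT \<sigma> T x) - grad \<sigma> (?xT \<sigma> T x)"
      by (intro grad_diff rewards_diff \<rho> \<sigma> yO)
    \<comment> \<open>The two-sided weight is at most 2, so \<open>r = 2 * R\<close>; with the four
      states of the residual this gives the 8 in \<theta>.\<close>
    have size: "norm (w t) \<le> 2 * R" if "branch \<tau> T x w" "\<tau> \<in> Rewards" "t \<le> T" for \<tau> w t
    proof -
      have "norm (w t) \<le> R * weight \<alpha> T t"
        using that branch_iff[OF that(2) T] by (simp add: wnorm_le_iff)
      also have "\<dots> \<le> R * 2" using R \<alpha> that by (intro mult_left_mono weight_le_2) auto
      finally show ?thesis by simp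
    qed
    have eqn: "L (w t, w (Suc t)) = - N (w t, w (Suc t))" if "branch \<tau> T x w" "\<tau> \<in> Rewards" "t < T" for \<tau> w t
      using that branch_iff[OF that(2) T] weighted_bvp.solves_def[OF bvp[OF that(2) T]] by simp
    show "norm (?z t - ?y t) \<le> Cz * norm ?b * ter_weight \<alpha>ter T t"
      unfolding Cz_def
    proof (rule terminal_difference_bound[OF linL L1 L1_det M[unfolded L0] Cto T _ CN CN0,
          where r = "2 * R" and S = S])
      show "0 < T" using T T0 by simp
      show "?z t \<in> tube" "?y t \<in> tube" if "t \<le> T" for t
        using in_tube \<rho> \<sigma> T zb yb that by blast+
      show "norm (?z t) \<le> 2 * R" "norm (?y t) \<le> 2 * R" if "t \<le> T" for t
        using size \<rho> \<sigma> zb yb that by blast+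
      show "L (?z t - ?y t, ?z (Suc t) - ?y (Suc t)) = - (N (?z t, ?z (Suc t)) - N (?y t, ?y (Suc t)))"
        if "t < T" for t
        using linear_diff[OF linL, of "(?z t, ?z (Suc t))" "(?y t, ?y (Suc t))"]
          eqn[OF zb \<rho> that] eqn[OF yb \<sigma> that] by simp
      show "fst (?z 0) = fst (?y 0)"
        using branch_ends(1)[OF zb] branch_ends(1)[OF yb]
        unfolding branch_x_def by (metis add_left_cancel)
      have "fst (?z T - ?y T) = ?d" by (simp add: branch_x_def)
      moreover have "snd (?z T - ?y T) = branch_p pinf ?z T - branch_p pinf ?y T"
        by (simp add: branch_p_def)
      ultimately show "snd (?z T - ?y T) = S *v fst (?z T - ?y T) + ?b"
        using branch_ends(2)[OF zb] branch_ends(2)[OF yb] S(1) b by simp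
      show "\<theta> = 4 * Cto * opnorm (matrix_inv L1) * CN * (1 + exp (- \<alpha>ter)) * (2 * R)"
        by (simp add: \<theta>_def)
    qed (use S(2) \<theta>_less t in auto)
  qed
  \<comment> \<open>\<open>Cz\<close> for the state; the control adds \<open>Bnu\<close> times the
    state differences at \<open>t\<close> and \<open>Suc t\<close>, the latter carrying a weight
    larger by \<open>exp \<alpha>ter\<close>.\<close>
  define Cter where "Cter = Cz + Bnu * (Cz + Cz * exp \<alpha>ter)"
  have Cter0: "0 \<le> Cter" using Cz0 Bnu0 by (simp add: Cter_def)
  have CzCter: "Cz \<le> Cter" using Cz0 Bnu0 by (simp add: Cter_def)
  \<comment> \<open>The estimates involve the gradient difference at one terminal state in \<X>.
    They are lifted to extended reals first, where the supremum always exists.\<close>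
  have sup: "ennreal q \<le> ennreal (Cter * e) * sup_norm \<X> (grad (\<lambda>y. \<rho> y - \<sigma> y))"
    if q: "q \<le> Cter * norm (grad (\<lambda>y. \<rho> y - \<sigma> y) w) * e" and w: "w \<in> \<X>" and e: "0 \<le> e" for q e \<rho> \<sigma> w
  proof -
    have "ennreal q \<le> ennreal ((Cter * e) * norm (grad (\<lambda>y. \<rho> y - \<sigma> y) w))"
      using q by (intro ennreal_leI) (simp add: algebra_simps)
    also have "\<dots> = ennreal (Cter * e) * ennreal (norm (grad (\<lambda>y. \<rho> y - \<sigma> y) w))"
      using Cter0 e by (intro ennreal_mult) auto
    also have "\<dots> \<le> ennreal (Cter * e) * sup_norm \<X> (grad (\<lambda>y. \<rho> y - \<sigma> y))"
      unfolding sup_norm_def by (intro mult_left_mono SUP_upper w) simp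
    finally show ?thesis .
  qed
  have sup_C2: "sup_norm \<X> (grad (\<lambda>y. \<rho> y - \<sigma> y)) \<le> C2_norm \<X> (\<lambda>y. \<rho> y - \<sigma> y)"
    if "\<rho> \<in> Rewards" "\<sigma> \<in> Rewards" for \<rho> \<sigma>
  proof -
    have "norm (grad (\<lambda>y. \<rho> y - \<sigma> y) w) = norm (Dop (\<lambda>y. \<rho> y - \<sigma> y) w)" if "w \<in> \<X>" for w
    proof -
      have "w \<in> O\<rho>" using that O\<rho>(2) by auto
      with rewards_diff \<open>\<rho> \<in> Rewards\<close> \<open>\<sigma> \<in> Rewards\<close>
      show ?thesis by (subst grad_eq_riesz) (auto simp: norm_riesz)
    qed
    then have "sup_norm \<X> (grad (\<lambda>y. \<rho> y - \<sigma> y)) = sup_norm \<X> (Dop (\<lambda>y. \<rho> y - \<sigma> y))"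
      by (simp add: sup_norm_def)
    then show ?thesis by (simp add: C2_norm_def le_max_iff_disj)
  qed
  have zu: "norm (z \<rho> T x t - z \<sigma> T x t) + norm (u \<rho> T x t - u \<sigma> T x t)
      \<le> Cter * norm (grad (\<lambda>y. \<rho> y - \<sigma> y) (?xT \<sigma> T x)) * ter_weight \<alpha>ter T t"
    if \<rho>: "\<rho> \<in> Rewards" and \<sigma>: "\<sigma> \<in> Rewards" and T: "T0 \<le> T" and x: "x \<in> X0" and t: "t < T"
    for \<rho> \<sigma> T x t
  proof -
    let ?b = "norm (grad (\<lambda>y. \<rho> y - \<sigma> y) (?xT \<sigma> T x))"
    have zb: "branch \<rho> T x (z \<rho> T x)" and yb: "branch \<sigma> T x (z \<sigma> T x)"
      by (intro z_branch X0_D \<rho> \<sigma> x T)+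
    have d0: "norm (z \<rho> T x t - z \<sigma> T x t) \<le> Cz * ?b * ter_weight \<alpha>ter T t"
      using t by (intro difference \<rho> \<sigma> T x) auto
    have "norm (z \<rho> T x (Suc t) - z \<sigma> T x (Suc t)) \<le> Cz * ?b * ter_weight \<alpha>ter T (Suc t)"
      using t by (intro difference \<rho> \<sigma> T x) auto
    also have "ter_weight \<alpha>ter T (Suc t) = exp \<alpha>ter * ter_weight \<alpha>ter T t"
      by (simp add: ter_weight_def mult_exp_exp algebra_simps)
    finally have d1: "norm (z \<rho> T x (Suc t) - z \<sigma> T x (Suc t)) \<le> Cz * ?b * (exp \<alpha>ter * ter_weight \<alpha>ter T t)" .
    have "norm (u \<rho> T x t - u \<sigma> T x t)
        \<le> Bnu * (norm (z \<rho> T x t - z \<sigma> T x t) + norm (z \<rho> T x (Suc t) - z \<sigma> T x (Suc t)))"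
      unfolding u using t by (intro u_lip in_tube[OF \<rho> T zb] in_tube[OF \<sigma> T yb]) auto
    also have "\<dots> \<le> Bnu * (Cz * ?b * ter_weight \<alpha>ter T t + Cz * ?b * (exp \<alpha>ter * ter_weight \<alpha>ter T t))"
      by (intro mult_left_mono add_mono d0 d1 Bnu0)
    finally show ?thesis using d0 by (simp add: Cter_def algebra_simps)
  qed
  have weight0: "ter_weight \<alpha>ter T 0 = exp (- \<alpha>ter * real T)" for T
    by (simp add: ter_weight_def)
  have to_C2: "a \<le> ennreal c * C2_norm \<X> (\<lambda>y. \<rho> y - \<sigma> y)"
    if "a \<le> ennreal c * sup_norm \<X> (grad (\<lambda>y. \<rho> y - \<sigma> y))" "\<rho> \<in> Rewards" "\<sigma> \<in> Rewards" for a c \<rho> \<sigma>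
    using that(1) mult_left_mono[OF sup_C2[OF that(2,3)], of "ennreal c"] by (meson order_trans zero_le)
  show ?thesis
  proof (intro conjI ballI allI impI exI[of _ Cter])
    fix \<rho> x T assume A: "\<rho> \<in> Rewards" "x \<in> X0" "T0 \<le> T"
    have zb: "branch \<rho> T x (z \<rho> T x)" by (intro z_branch X0_D A)
    then show "is_branch F l lam nu xinf pinf \<alpha> R \<rho> T x (z \<rho> T x)" by (simp only: branch_def)
    \<comment> \<open>Uniqueness is the Lipschitz estimate with equal initial states.\<close>
    show "y t = z \<rho> T x t" if "is_branch F l lam nu xinf pinf \<alpha> R \<rho> T x y" "t \<le> T" for y t
      using lipschitz[OF A(1,3) _ zb that(2), of x y] that(1) by (simp add: branch_def)
    show "GDERIV (\<S> \<rho> T) x :> branch_p pinf (z \<rho> T x) 0" by (rule gradient[OF A(1,3,2)])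
  next
    fix x \<rho> \<sigma> T assume A: "x \<in> X0" "\<rho> \<in> Rewards" "\<sigma> \<in> Rewards" "T0 \<le> T"
    note X = terminal_mem[OF A(2,3,4,1) le0]
    show "ennreal (norm (z \<rho> T x t - z \<sigma> T x t) + norm (u \<rho> T x t - u \<sigma> T x t))
        \<le> ennreal (Cter * exp (- \<alpha>ter * (real T - real t))) * sup_norm \<X> (grad (\<lambda>y. \<rho> y - \<sigma> y))"
      if "t < T" for t
      using zu[OF A(2,3,4,1) that] by (intro sup[OF _ X]) (simp_all add: ter_weight_def)
    \<comment> \<open>Time 0 lies strictly before the horizon because
      \<open>T0 \<ge> 1\<close>.\<close>
    have "norm (\<K> \<rho> T x - \<K> \<sigma> T x)
        \<le> Cter * norm (grad (\<lambda>y. \<rho> y - \<sigma> y) (?xT \<sigma> T x)) * exp (- \<alpha>ter * real T)"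
      using zu[OF A(2,3,4,1), of 0] A(4) T0 norm_ge_zero[of "z \<rho> T x 0 - z \<sigma> T x 0"]
      unfolding \<K> weight0 by linarith
    from sup[OF this X] show "ennreal (norm (\<K> \<rho> T x - \<K> \<sigma> T x))
        \<le> ennreal (Cter * exp (- \<alpha>ter * real T)) * C2_norm \<X> (\<lambda>y. \<rho> y - \<sigma> y)"
      by (intro to_C2 A) simp
    \<comment> \<open>Both gradients are initial costates, hence components of the deviations at
      time 0, and the state bound applies.\<close>
    have "norm (grad (\<S> \<rho> T) x - grad (\<S> \<sigma> T) x) = norm (snd (z \<rho> T x 0 - z \<sigma> T x 0))"
      using gradient[OF A(2,4,1)] gradient[OF A(3,4,1)] by (simp add: GDERIV_imp_grad_eq branch_p_def)
    also have "\<dots> \<le> norm (z \<rho> T x 0 - z \<sigma> T x 0)"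
      by (rule snd_le)
    also have "\<dots> \<le> Cz * norm (grad (\<lambda>y. \<rho> y - \<sigma> y) (?xT \<sigma> T x)) * ter_weight \<alpha>ter T 0"
      by (rule difference[OF A(2,3,4,1) le0])
    also have "\<dots> \<le> Cter * norm (grad (\<lambda>y. \<rho> y - \<sigma> y) (?xT \<sigma> T x)) * exp (- \<alpha>ter * real T)"
      unfolding weight0 by (intro mult_right_mono CzCter) auto
    finally show G: "ennreal (norm (grad (\<S> \<rho> T) x - grad (\<S> \<sigma> T) x))
        \<le> ennreal (Cter * exp (- \<alpha>ter * real T)) * sup_norm \<X> (grad (\<lambda>y. \<rho> y - \<sigma> y))"
      by (intro sup[OF _ X]) simp_all
    show "ennreal (norm (grad (\<S> \<rho> T) x - grad (\<S> \<sigma> T) x))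
        \<le> ennreal (Cter * exp (- \<alpha>ter * real T)) * C2_norm \<X> (\<lambda>y. \<rho> y - \<sigma> y)"
      by (rule to_C2[OF G A(2,3)])
  qed
qed

end
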